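(* Let $n_1,n_2\in\mathbb{Z}^+$, $n=\operatorname{lcm}(n_1,n_2)$ and $g=\gcd(n_1,n_2)$. Let $x=(E,\langle P\rangle)\in X_0(n)$ for an elliptic curve $E$ with $j(E)\notin\{0,1728\}$, and set $x_1=(E,\langle \tfrac{n_2}{g}P\rangle)\in X_0(n_1)$ and $x_2=(E,\langle\tfrac{n_1}{g}P\rangle)\in X_0(n_2)$. Then the residue field $\mathbb{Q}(x)$ equals the compositum $\mathbb{Q}(x_1)\mathbb{Q}(x_2)$.
   Context: $X_0(N)$ is the modular curve over $\mathbb{Q}$ whose non-cuspidal points parametrize pairs $(E,\langle P\rangle)$ of an elliptic curve and a cyclic subgroup of order $N$; $\mathbb{Q}(x)$ denotes the residue field of the (closed) point $x$. *)

theory Defs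
  imports
    "HOL-Library.Poly_Mapping"
    "HOL-Algebra.Algebraic_Closure_Type"
    "HOL-Algebra.Generated_Groups"
    "HOL-Algebra.Generated_Fields"
begin

type_synonym qbar = "rat alg_closure"

definition gal_Q :: "(qbar \<Rightarrow> qbar) set" where
  "gal_Q = {\<sigma>. bij \<sigma> \<and> (\<forall>x y. \<sigma> (x + y) = \<sigma> x + \<sigma> y) \<and> (\<forall>x y. \<sigma> (x * y) = \<sigma> x * \<sigma> y)}"


section \<open>Elliptic curves and their cyclic subgroups\<close>

text \<open>
  In characteristic 0 every elliptic curve has a short Weierstrass equation
  \<open>y\<^sup>2 = x\<^sup>3 + a x + b\<close>; the pair \<open>(a, b)\<close> stands for that curve.
\<close>

type_synonym curve = "qbar \<times> qbar"

datatype 'a ec_point = Infinity | Affine 'a 'a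

fun elliptic :: "curve \<Rightarrow> bool" where
  "elliptic (a, b) \<longleftrightarrow> 4 * a ^ 3 + 27 * b ^ 2 \<noteq> 0"

fun j_inv :: "curve \<Rightarrow> qbar" where
  "j_inv (a, b) = 1728 * (4 * a ^ 3) / (4 * a ^ 3 + 27 * b ^ 2)"

fun on_curve :: "curve \<Rightarrow> qbar ec_point \<Rightarrow> bool" where
  "on_curve (a, b) Infinity \<longleftrightarrow> True"
| "on_curve (a, b) (Affine x y) \<longleftrightarrow> y ^ 2 = x ^ 3 + a * x + b"

fun ec_add :: "curve \<Rightarrow> qbar ec_point \<Rightarrow> qbar ec_point \<Rightarrow> qbar ec_point" where
  "ec_add (a, b) Infinity Q = Q"
| "ec_add (a, b) (Affine x1 y1) Infinity = Affine x1 y1"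
| "ec_add (a, b) (Affine x1 y1) (Affine x2 y2) =
    (if x1 = x2 \<and> y1 = - y2 then Infinity
     else let l = (if x1 = x2 then (3 * x1 ^ 2 + a) / (2 * y1) else (y2 - y1) / (x2 - x1));
              x3 = l ^ 2 - x1 - x2
          in Affine x3 (l * (x1 - x3) - y1))"

definition ec_group :: "curve \<Rightarrow> qbar ec_point monoid" where
  "ec_group E = \<lparr> carrier = {P. on_curve E P}, monoid.mult = ec_add E, one = Infinity \<rparr>"

type_synonym level_pair = "curve \<times> qbar ec_point set"

definition Gamma0_pairs :: "nat \<Rightarrow> level_pair set" where
  "Gamma0_pairs N = {(E, C). elliptic E \<and>
     (\<exists>P \<in> carrier (ec_group E). C = generate (ec_group E) {P}) \<and> card C = N}"

fun ec_scale :: "qbar \<Rightarrow> qbar ec_point \<Rightarrow> qbar ec_point" where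
  "ec_scale u Infinity = Infinity"
| "ec_scale u (Affine x y) = Affine (u ^ 2 * x) (u ^ 3 * y)"

text \<open>
  The isomorphisms of elliptic curves between two short Weierstrass equations are exactly the
  substitutions \<open>(x, y) \<mapsto> (u\<^sup>2 x, u\<^sup>3 y)\<close>.
\<close>

fun pair_iso :: "level_pair \<Rightarrow> level_pair \<Rightarrow> bool" where
  "pair_iso ((a, b), C) ((a', b'), C') \<longleftrightarrow>
     (\<exists>u. u \<noteq> 0 \<and> a' = u ^ 4 * a \<and> b' = u ^ 6 * b \<and> C' = ec_scale u ` C)"

fun conj_pair :: "(qbar \<Rightarrow> qbar) \<Rightarrow> level_pair \<Rightarrow> level_pair" where
  "conj_pair \<sigma> ((a, b), C) = ((\<sigma> a, \<sigma> b), map_ec_point \<sigma> ` C)"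


section \<open>Projective curves over the rationals and residue fields\<close>

text \<open>
  A polynomial is a finitely supported map from exponent vectors to coefficients. Points of
  \<open>P\<^sup>m\<close> over the algebraic closure are the classes, up to scaling, of nonzero vectors
  whose coordinates of index greater than \<open>m\<close> vanish.
\<close>

type_synonym mpol = "(nat \<Rightarrow>\<^sub>0 nat) \<Rightarrow>\<^sub>0 qbar"

type_synonym ppoint = "(nat \<Rightarrow> qbar) set"

definition mpol_eval :: "mpol \<Rightarrow> (nat \<Rightarrow> qbar) \<Rightarrow> qbar" where
  "mpol_eval F v = (\<Sum>e \<in> Poly_Mapping.keys F. Poly_Mapping.lookup F e *
     (\<Prod>k \<in> Poly_Mapping.keys e. v k ^ Poly_Mapping.lookup e k))"

text \<open>The value at \<open>v\<close> of the formal partial derivative in the \<open>i\<close>-th variable.\<close>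

definition mpol_partial :: "nat \<Rightarrow> mpol \<Rightarrow> (nat \<Rightarrow> qbar) \<Rightarrow> qbar" where
  "mpol_partial i F v = (\<Sum>e \<in> Poly_Mapping.keys F.
     Poly_Mapping.lookup F e * of_nat (Poly_Mapping.lookup e i) *
     (\<Prod>k \<in> Poly_Mapping.keys e. v k ^ (Poly_Mapping.lookup e k - (if k = i then 1 else 0))))"

definition hom_form :: "nat \<Rightarrow> nat \<Rightarrow> mpol \<Rightarrow> bool" where
  "hom_form m d F \<longleftrightarrow> (\<forall>e \<in> Poly_Mapping.keys F.
     Poly_Mapping.keys e \<subseteq> {..m} \<and> (\<Sum>k\<le>m. Poly_Mapping.lookup e k) = d)"

definition rational_form :: "nat \<Rightarrow> nat \<Rightarrow> mpol \<Rightarrow> bool" where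
  "rational_form m d F \<longleftrightarrow> hom_form m d F \<and> (\<forall>e. Poly_Mapping.lookup F e \<in> \<rat>)"

definition proj_space :: "nat \<Rightarrow> ppoint set" where
  "proj_space m = {{(\<lambda>i. c * v i) | c. c \<noteq> 0} | v. v \<noteq> (\<lambda>i. 0) \<and> (\<forall>i>m. v i = 0)}"

definition conj_point :: "(qbar \<Rightarrow> qbar) \<Rightarrow> ppoint \<Rightarrow> ppoint" where
  "conj_point \<sigma> p = (\<lambda>v. \<sigma> \<circ> v) ` p"

definition vanishes_on :: "mpol \<Rightarrow> ppoint set \<Rightarrow> bool" where
  "vanishes_on F V \<longleftrightarrow> (\<forall>p \<in> V. \<forall>v \<in> p. mpol_eval F v = 0)"

definition rational_ideal :: "nat \<Rightarrow> ppoint set \<Rightarrow> mpol set" where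
  "rational_ideal m V = {F. (\<exists>d. rational_form m d F) \<and> vanishes_on F V}"

definition affine_tangent :: "nat \<Rightarrow> ppoint set \<Rightarrow> (nat \<Rightarrow> qbar) \<Rightarrow> (nat \<Rightarrow> qbar) set" where
  "affine_tangent m V v = {w. (\<forall>i>m. w i = 0) \<and>
     (\<forall>F \<in> rational_ideal m V. (\<Sum>i\<le>m. mpol_partial i F v * w i) = 0)}"

text \<open>
  Smooth, projective, geometrically irreducible curves over the rationals, given by their sets
  of geometric points: Zariski closed over the rationals, irreducible over the algebraic
  closure, and with affine cone having a tangent space of dimension 2 at every nonzero vector
  \<open>v\<close>, so that the curve itself has a 1-dimensional tangent space at every point. By Euler's
  relation \<open>v\<close> always is one of the basis vectors of that tangent space.
\<close>

definition smooth_projective_curve :: "nat \<Rightarrow> ppoint set \<Rightarrow> bool" where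
  "smooth_projective_curve m V \<longleftrightarrow>
     V \<noteq> {} \<and>
     V = {p \<in> proj_space m. \<forall>F \<in> rational_ideal m V. vanishes_on F {p}} \<and>
     (\<forall>F G d e. hom_form m d F \<and> hom_form m e G \<and>
        (\<forall>p \<in> V. vanishes_on F {p} \<or> vanishes_on G {p}) \<longrightarrow>
        vanishes_on F V \<or> vanishes_on G V) \<and>
     (\<forall>p \<in> V. \<forall>v \<in> p. \<exists>w. (\<forall>c. w \<noteq> (\<lambda>i. c * v i)) \<and>
        affine_tangent m V v = {(\<lambda>i. c * v i + d * w i) | c d. True})"

text \<open>
  A geometric point \<open>p\<close> lies over a unique closed point. The local ring there consists of the
  fractions \<open>F / G\<close> of rational forms of equal degree with \<open>G\<close> not vanishing at \<open>p\<close>, and its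
  maximal ideal of those vanishing at \<open>p\<close>; so evaluation at \<open>p\<close> identifies the residue field
  with the following subfield of the algebraic closure.
\<close>

definition residue_field :: "nat \<Rightarrow> ppoint \<Rightarrow> qbar set" where
  "residue_field m p = {mpol_eval F v / mpol_eval G v | v F G d.
     v \<in> p \<and> rational_form m d F \<and> rational_form m d G \<and> mpol_eval G v \<noteq> 0}"

definition compositum :: "qbar set \<Rightarrow> qbar set \<Rightarrow> qbar set" where
  "compositum K L = generate_field ring_of_type_algebra (K \<union> L)"


section \<open>The modular curve of level Gamma0\<close>

text \<open>
  \<open>V\<close> is the set of geometric points of a projective model of the modular curve over the
  rationals, and \<open>\<Phi>\<close> is its moduli interpretation, sending a pair \<open>(E, C)\<close> to the
  non-cuspidal point it represents. As the curve and its moduli interpretation are defined over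
  the rationals, \<open>\<Phi>\<close> commutes with the Galois action and the \<open>j\<close>-invariant is a rational
  function over the rationals that is regular at all non-cuspidal points.
\<close>

locale modular_curve_X0 =
  fixes N m :: nat and V :: "ppoint set" and \<Phi> :: "level_pair \<Rightarrow> ppoint"
  assumes level_pos: "N > 0"
    and curve: "smooth_projective_curve m V"
    and moduli_point: "\<And>x. x \<in> Gamma0_pairs N \<Longrightarrow> \<Phi> x \<in> V"
    and moduli_eq_iff: "\<And>x y. x \<in> Gamma0_pairs N \<Longrightarrow> y \<in> Gamma0_pairs N \<Longrightarrow>
          \<Phi> x = \<Phi> y \<longleftrightarrow> pair_iso x y"
    and finite_cusps: "finite (V - \<Phi> ` Gamma0_pairs N)"
    and galois_equivariant: "\<And>\<sigma> x. \<sigma> \<in> gal_Q \<Longrightarrow> x \<in> Gamma0_pairs N \<Longrightarrow>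
          \<Phi> (conj_pair \<sigma> x) = conj_point \<sigma> (\<Phi> x)"
    and j_regular: "\<And>x. x \<in> Gamma0_pairs N \<Longrightarrow>
          \<exists>d F G. rational_form m d F \<and> rational_form m d G \<and>
            (\<forall>v \<in> \<Phi> x. mpol_eval G v \<noteq> 0) \<and>
            (\<forall>y \<in> Gamma0_pairs N. \<forall>v \<in> \<Phi> y. mpol_eval G v \<noteq> 0 \<longrightarrow>
               j_inv (fst y) = mpol_eval F v / mpol_eval G v)"

end

theory Submission
  imports Defs "HOL-Computational_Algebra.Formal_Laurent_Series" "HOL-Library.Set_Algebras"
begin

text \<open>
  By Galois theory it suffices that an automorphism \<open>\<sigma>\<close> of the algebraic closure fixes the residue
  field of \<open>x\<close> pointwise iff it fixes those of \<open>x1\<close> and \<open>x2\<close>. It fixes the residue field of a point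
  iff it fixes the point, i.e. iff the conjugate pair is isomorphic to the original one. For
  \<open>j \<notin> {0, 1728}\<close> an isomorphism of curves is unique up to sign, so the isomorphisms obtained from \<open>x1\<close> and
  \<open>x2\<close> agree on subgroups. Composed with \<open>\<sigma>\<close> they give an automorphism of the group of points that
  preserves \<open>\<langle>P\<rangle>\<close> iff it preserves \<open>\<langle>(n2/g) P\<rangle>\<close> and \<open>\<langle>(n1/g) P\<rangle>\<close>, as \<open>n1/g\<close> and \<open>n2/g\<close> are coprime.

  Associativity of the chord-tangent law is proved with ideals of the coordinate ring: if the two
  bracketings of a triple sum differed, a quotient of products of lines would be a
  function with a single simple pole at infinity, which does not exist.
\<close>

section \<open>The group law on a Weierstrass curve\<close>

text \<open>The coordinate ring is realised inside the field of Laurent series in a local parameter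
  t at infinity, with x = t^-2 and y = t^-3 sqrt(1 + a t^4 + b t^6), so that the pole order at
  infinity is minus the subdegree. The ideal argument uses only inclusions: they are multiplied
  together, and a nonzero principal factor is cancelled. Its core is that the ideals of P and -P
  multiply to the principal ideal of x - x(P); smoothness of the curve is what makes this true. As
  the algebraic closure is an infinite extension, automorphisms are built by Zorn's lemma from
  graphs of partial homomorphisms. A point is recovered from its residue field because, once some
  coordinate is scaled to 1, all coordinates lie in that field. The obstacle in the last step is
  that \<open>x1\<close> and \<open>x2\<close> each provide their own scalar u, while a single one
  has to preserve both subgroups. The curve prescribes u^4 if a is nonzero and u^6 if b is nonzero;
  only with both is u^2 = u^6 / u^4 determined, which is where j = 0 and j = 1728 drop out.\<close>

fun ec_neg :: "qbar ec_point \<Rightarrow> qbar ec_point" where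
  "ec_neg Infinity = Infinity"
| "ec_neg (Affine x y) = Affine x (- y)"

section \<open>Laurent expansions at infinity and the coordinate ring\<close>

locale weierstrass =
  fixes a b :: qbar
  assumes nonsingular: "4 * a ^ 3 + 27 * b ^ 2 \<noteq> 0"
begin

abbreviation K :: "qbar \<Rightarrow> qbar fls" where "K \<equiv> fls_const"

definition cx :: "qbar fls" where "cx = fls_X_inv ^ 2"

text \<open>The radicand is y^2 / x^3 = 1 + a / x^2 + b / x^3 written in the local parameter. The
  constant function 1 given to \<open>fps_radical\<close> selects the square root with constant term
  1.\<close>

definition cy_unit :: "qbar fps" where
  "cy_unit = fps_radical (\<lambda>_ _. 1) 2 (1 + fps_const a * fps_X ^ 4 + fps_const b * fps_X ^ 6)"

definition cy :: "qbar fls" where "cy = fls_X_inv ^ 3 * fps_to_fls cy_unit"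

lemma fls_X_power_cancel: "fls_X ^ n * (fls_X_inv :: qbar fls) ^ n = 1"
  by (simp add: power_mult_distrib[symmetric] fls_X_inv_times_conv_shift fls_X_conv_shift_1)

lemma cy_unit_square: "cy_unit ^ 2 = 1 + fps_const a * fps_X ^ 4 + fps_const b * fps_X ^ 6"
proof -
  let ?s = "1 + fps_const a * fps_X ^ 4 + fps_const b * fps_X ^ 6"
  have "?s $ 0 = 1" by simp
  then show ?thesis
    using power_radical[of ?s "\<lambda>_ _. 1" 1] by (simp add: cy_unit_def numeral_2_eq_2)
qed

lemma cy_square: "cy ^ 2 = cx ^ 3 + K a * cx + K b"
proof -
  have e: "(fls_X_inv :: qbar fls) ^ 6 = fls_X_inv ^ 2 * fls_X_inv ^ 4"
    by (simp flip: power_add)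
  have "cy ^ 2 = fls_X_inv ^ 6 * fps_to_fls (cy_unit ^ 2)"
    by (simp add: cy_def power_mult_distrib fps_to_fls_power flip: power_mult)
  also have "\<dots> = fls_X_inv ^ 6 + K a * fls_X_inv ^ 2 * (fls_X ^ 4 * fls_X_inv ^ 4)
      + K b * (fls_X ^ 6 * fls_X_inv ^ 6)"
    by (simp only: cy_unit_square fps_to_fls_plus fls_times_fps_to_fls fps_to_fls_power fps_one_to_fls
        fps_const_to_fls fps_X_to_fls distrib_left mult_1_right mult_1_left e mult_ac)
  also have "\<dots> = cx ^ 3 + K a * cx + K b"
    by (simp add: fls_X_power_cancel cx_def flip: power_mult)
  finally show ?thesis .
qed

lemma cy_mult_cy: "cy * cy = cx * cx * cx + K a * cx + K b"
  using cy_square by (simp add: power2_eq_square power3_eq_cube)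

lemma subdegree_cx: "fls_subdegree cx = -2"
  by (simp add: cx_def)

lemma subdegree_cy: "fls_subdegree cy = -3"
proof -
  have "cy_unit $ 0 = 1" by (simp add: cy_unit_def)
  then have u: "fls_subdegree (fps_to_fls cy_unit) = 0" "fps_to_fls cy_unit \<noteq> 0"
    by (auto simp: fls_subdegree_fls_to_fps)
  then show ?thesis by (simp add: cy_def)
qed

lemma cx_nonzero: "cx \<noteq> 0" and cy_nonzero: "cy \<noteq> 0"
  using subdegree_cx subdegree_cy by auto

definition ev :: "qbar poly \<Rightarrow> qbar fls" where
  "ev p = poly (map_poly K p) cx"

lemma ev_0 [simp]: "ev 0 = 0"
  by (simp add: ev_def)

lemma ev_pCons [simp]: "ev (pCons c p) = K c + cx * ev p"
  by (simp add: ev_def map_poly_pCons)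

lemma ev_add: "ev (p + q) = ev p + ev q"
  by (induction p q rule: poly_induct2) (simp_all add: algebra_simps flip: fls_plus_const)

lemma ev_smult: "ev (smult c p) = K c * ev p"
  by (induction p) (simp_all add: algebra_simps flip: fls_const_mult_const)

lemma ev_mult: "ev (p * q) = ev p * ev q"
  by (induction p) (simp_all add: ev_add ev_smult algebra_simps)

lemma subdegree_ev:
  assumes "p \<noteq> 0"
  shows "ev p \<noteq> 0 \<and> fls_subdegree (ev p) = - 2 * int (degree p)"
  using assms
proof (induction p)
  case (pCons c p)
  show ?case
  proof (cases "p = 0")
    case False
    with pCons have s: "fls_subdegree (cx * ev p) = - 2 - 2 * int (degree p)" "cx * ev p \<noteq> 0"
      by (auto simp: subdegree_cx cx_nonzero)
    then have "fls_subdegree (cx * ev p + K c) = - 2 - 2 * int (degree p)"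
      by (subst fls_subdegree_add_eq1) auto
    moreover from this have "cx * ev p + K c \<noteq> 0"
      by auto
    ultimately show ?thesis
      using False by (simp add: add.commute)
  qed (use pCons in auto)
qed simp

text \<open>Normal form of the affine coordinate ring: by the Weierstrass equation it is spanned by
  1 and y over the polynomials in x. The two summands have pole orders of different parity.\<close>

definition coord_ring :: "qbar fls set" where
  "coord_ring = {ev p + ev q * cy | p q. True}"

lemma const_in_ring: "K c \<in> coord_ring"
  unfolding coord_ring_def by (rule CollectI, rule exI[of _ "[:c:]"], rule exI[of _ 0]) simp

lemma cx_in_ring: "cx \<in> coord_ring"
  unfolding coord_ring_def by (rule CollectI, rule exI[of _ "[:0, 1:]"], rule exI[of _ 0]) simp

lemma cy_in_ring: "cy \<in> coord_ring"
  unfolding coord_ring_def by (rule CollectI, rule exI[of _ 0], rule exI[of _ "[:1:]"]) simp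

lemma add_in_ring:
  assumes "u \<in> coord_ring" "w \<in> coord_ring"
  shows "u + w \<in> coord_ring"
proof -
  obtain p q p' q' where "u = ev p + ev q * cy" "w = ev p' + ev q' * cy"
    using assms unfolding coord_ring_def by blast
  then have "u + w = ev (p + p') + ev (q + q') * cy"
    by (simp add: ev_add algebra_simps)
  then show ?thesis
    unfolding coord_ring_def by blast
qed

lemma mult_in_ring:
  assumes "u \<in> coord_ring" "w \<in> coord_ring"
  shows "u * w \<in> coord_ring"
proof -
  obtain p q p' q' where "u = ev p + ev q * cy" "w = ev p' + ev q' * cy"
    using assms unfolding coord_ring_def by blast
  then have "u * w = ev p * ev p' + ev q * ev q' * (cy * cy) + (ev p * ev q' + ev q * ev p') * cy"
    by (simp add: algebra_simps)
  also have "cy * cy = ev [:b, a, 0, 1:]"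
    unfolding cy_mult_cy by (simp add: algebra_simps)
  finally have "u * w = ev (p * p' + q * q' * [:b, a, 0, 1:]) + ev (p * q' + q * p') * cy"
    by (simp only: ev_add ev_mult)
  then show ?thesis
    unfolding coord_ring_def by blast
qed

lemma numeral_in_ring: "numeral k \<in> coord_ring" "1 \<in> coord_ring" "0 \<in> coord_ring"
  using const_in_ring[of "numeral k"] const_in_ring[of 1] const_in_ring[of 0] by simp_all

lemma uminus_in_ring: "u \<in> coord_ring \<Longrightarrow> - u \<in> coord_ring"
  using mult_in_ring[OF const_in_ring[of "-1"], of u] by (simp add: fls_const_uminus)

lemma diff_in_ring: "u \<in> coord_ring \<Longrightarrow> w \<in> coord_ring \<Longrightarrow> u - w \<in> coord_ring"
  using add_in_ring[OF _ uminus_in_ring, of u w] by simp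

lemmas ring_intros = const_in_ring cx_in_ring cy_in_ring add_in_ring mult_in_ring
  numeral_in_ring uminus_in_ring diff_in_ring

text \<open>No function on the curve has a single simple pole: \<open>- fls_subdegree\<close> is the pole order at
  infinity, which is even for \<open>p(x)\<close> and odd and at least 3 for \<open>q(x) y\<close>.\<close>

lemma subdegree_in_ring:
  assumes "u \<in> coord_ring"
  shows "fls_subdegree u \<noteq> -1"
proof -
  obtain p q where u: "u = ev p + ev q * cy"
    using assms unfolding coord_ring_def by blast
  have q: "ev q * cy \<noteq> 0 \<and> fls_subdegree (ev q * cy) = - 2 * int (degree q) - 3" if "q \<noteq> 0"
    using subdegree_ev[OF that] by (simp add: cy_nonzero subdegree_cy)
  consider "p = 0" "q = 0" | "p = 0" "q \<noteq> 0" | "p \<noteq> 0" "q = 0" | "p \<noteq> 0" "q \<noteq> 0" by blast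
  then show ?thesis
  proof cases
    case 4
    have p: "ev p \<noteq> 0" "fls_subdegree (ev p) = - 2 * int (degree p)"
      using subdegree_ev[OF 4(1)] by auto
    have "fls_subdegree (ev p) < fls_subdegree (ev q * cy) \<or> fls_subdegree (ev q * cy) < fls_subdegree (ev p)"
      using q[OF 4(2)] p by presburger
    then show ?thesis
    proof
      assume "fls_subdegree (ev p) < fls_subdegree (ev q * cy)"
      from fls_subdegree_add_eq1[OF p(1) this] show ?thesis
        using p(2) unfolding u by presburger
    next
      assume "fls_subdegree (ev q * cy) < fls_subdegree (ev p)"
      from fls_subdegree_add_eq2[OF _ this] show ?thesis
        using q[OF 4(2)] unfolding u by auto
    qed
  next
    case 3
    then show ?thesis using subdegree_ev[of p] unfolding u by (simp, presburger)
  qed (use q u in auto)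
qed

section \<open>Inclusion calculus for products of ideals\<close>

inductive_set ideal_gen :: "qbar fls set \<Rightarrow> qbar fls set" for S where
  zero: "0 \<in> ideal_gen S"
| step: "r \<in> coord_ring \<Longrightarrow> s \<in> S \<Longrightarrow> y \<in> ideal_gen S \<Longrightarrow> r * s + y \<in> ideal_gen S"

text \<open>Ideals are compared through generating sets. The product of ideals is then the
  elementwise product of sets, which is literally associative and commutative, so chains of
  inclusions can be rearranged by \<open>mult_ac\<close>.\<close>

definition below :: "qbar fls set \<Rightarrow> qbar fls set \<Rightarrow> bool" (infix "\<sqsubseteq>" 50) where
  "S \<sqsubseteq> T \<longleftrightarrow> S \<subseteq> ideal_gen T"

lemma below_insert [simp]: "insert s S \<sqsubseteq> T \<longleftrightarrow> s \<in> ideal_gen T \<and> S \<sqsubseteq> T"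
  by (simp add: below_def)

lemma below_empty [simp]: "{} \<sqsubseteq> T"
  by (simp add: below_def)

lemma ideal_gen_mult: "r \<in> coord_ring \<Longrightarrow> s \<in> S \<Longrightarrow> r * s \<in> ideal_gen S"
  using ideal_gen.step[OF _ _ ideal_gen.zero] by simp

lemma ideal_gen_base: "s \<in> S \<Longrightarrow> s \<in> ideal_gen S"
  using ideal_gen_mult[OF numeral_in_ring(2)] by simp

lemma ideal_gen_add: "y \<in> ideal_gen S \<Longrightarrow> z \<in> ideal_gen S \<Longrightarrow> y + z \<in> ideal_gen S"
  by (induction y rule: ideal_gen.induct) (simp_all add: ideal_gen.step add.assoc)

lemma ideal_gen_scale: "y \<in> ideal_gen S \<Longrightarrow> r \<in> coord_ring \<Longrightarrow> r * y \<in> ideal_gen S"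
  by (induction y rule: ideal_gen.induct)
     (simp_all add: ideal_gen.intros ring_intros distrib_left flip: mult.assoc)

lemma below_refl: "S \<sqsubseteq> S"
  using ideal_gen_base unfolding below_def by blast

lemma below_eq_trans [trans]: "S \<sqsubseteq> T \<Longrightarrow> T = U \<Longrightarrow> S \<sqsubseteq> U"
  and eq_below_trans [trans]: "S = T \<Longrightarrow> T \<sqsubseteq> U \<Longrightarrow> S \<sqsubseteq> U"
  by simp_all

lemma below_trans [trans]:
  assumes "S \<sqsubseteq> T" "T \<sqsubseteq> U"
  shows "S \<sqsubseteq> U"
proof -
  have "y \<in> ideal_gen U" if "y \<in> ideal_gen T" for y
    using that assms(2) unfolding below_def
    by (induction y rule: ideal_gen.induct) (auto intro: ideal_gen.zero ideal_gen_add ideal_gen_scale)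
  with assms(1) show ?thesis unfolding below_def by blast
qed

lemma mult_mem_ideal_gen: "y \<in> ideal_gen S \<Longrightarrow> u \<in> U \<Longrightarrow> u * y \<in> ideal_gen (U * S)"
proof (induction y rule: ideal_gen.induct)
  case (step r s y)
  have "r * (u * s) + u * y \<in> ideal_gen (U * S)"
    using step by (intro ideal_gen.step) (auto intro: set_times_intro)
  then show ?case by (simp add: algebra_simps)
qed (simp add: ideal_gen.zero)

lemma below_mult_left: "S \<sqsubseteq> T \<Longrightarrow> U * S \<sqsubseteq> U * T"
  using mult_mem_ideal_gen unfolding below_def by (auto elim!: set_times_elim)

lemma below_mult: "S \<sqsubseteq> T \<Longrightarrow> S' \<sqsubseteq> T' \<Longrightarrow> S * S' \<sqsubseteq> T * T'"
  using below_trans[OF below_mult_left[of S' T' S] below_mult_left[of S T T', unfolded mult.commute[of T']]]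
  by simp

lemma ideal_gen_singleton_mult: "y \<in> ideal_gen ({c} * T) \<Longrightarrow> \<exists>z \<in> ideal_gen T. y = c * z"
proof (induction y rule: ideal_gen.induct)
  case (step r s y)
  then obtain t z where "s = c * t" "t \<in> T" "z \<in> ideal_gen T" "y = c * z"
    by (auto elim!: set_times_elim)
  with step show ?case
    by (intro bexI[of _ "r * t + z"]) (simp_all add: distrib_left mult.left_commute ideal_gen.step)
qed (use ideal_gen.zero in force)

text \<open>Every member of the ideal generated by \<open>{c} * T\<close> is \<open>c\<close> times
  a member of the ideal of \<open>T\<close>, and the Laurent series form a field, so
  \<open>c\<close> cancels.\<close>

lemma below_cancel:
  assumes "c \<noteq> 0" "{c} * S \<sqsubseteq> {c} * T"
  shows "S \<sqsubseteq> T"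
  unfolding below_def
proof
  fix s assume "s \<in> S"
  then have "c * s \<in> ideal_gen ({c} * T)"
    using assms(2) unfolding below_def by (auto intro: set_times_intro)
  with ideal_gen_singleton_mult obtain z where "z \<in> ideal_gen T" "c * s = c * z" by blast
  with assms(1) show "s \<in> ideal_gen T" by simp
qed

lemma ideal_gen_in_ring: "y \<in> ideal_gen S \<Longrightarrow> S \<subseteq> coord_ring \<Longrightarrow> y \<in> coord_ring"
  by (induction y rule: ideal_gen.induct) (auto intro: ring_intros)

lemma singleton_times: "{c} * {d} = {c * d :: qbar fls}"
  by (auto simp: set_times_def)

lemma insert_times: "insert c C * D = (*) c ` D \<union> C * (D :: qbar fls set)"
  and empty_times: "{} * D = ({} :: qbar fls set)"
  by (auto simp: set_times_def)

lemma one_times [simp]: "{1} * S = S" "S * {1} = (S :: qbar fls set)"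
  using mult_1_left[of S] mult_1_right[of S] by simp_all

lemma pair_times: "{c, c'} * {d, d'} = {c * d, c * d', c' * d, c' * d' :: qbar fls}"
  by (simp add: insert_times empty_times insert_commute)

lemma pair_times_triple:
  "{c, c'} * {d, d'} * {f} = {c * d * f, c * d' * f, c' * d * f, c' * d' * f :: qbar fls}"
  by (simp add: insert_times empty_times insert_commute)

lemma singleton_times_pair: "{c} * {d, d'} = {c * d, c * d' :: qbar fls}"
  by (simp add: insert_times empty_times)

lemma ideal_gen_pairI:
  "r \<in> coord_ring \<Longrightarrow> r' \<in> coord_ring \<Longrightarrow> y = r * s + r' * s' \<Longrightarrow> y \<in> ideal_gen {s, s'}"
  by (auto intro!: ideal_gen_add ideal_gen_mult)

section \<open>Ideals of affine points, lines and vertical lines\<close>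

definition G :: "qbar \<Rightarrow> qbar \<Rightarrow> qbar fls set" where
  "G x y = {cx - K x, cy - K y}"

lemma G_product:
  "G x y * G x' y' =
   {(cx - K x) * (cx - K x'), (cx - K x) * (cy - K y'), (cy - K y) * (cx - K x'), (cy - K y) * (cy - K y')}"
  by (simp add: G_def pair_times)

text \<open>The hypotheses say that the line \<open>y = l x + c\<close> meets the curve in the points over
  \<open>x1\<close>, \<open>x2\<close> and \<open>x3\<close>, i.e. \<open>t\<^sup>3 + a t + b - (l t + c)\<^sup>2 = (t - x1) (t - x2) (t - x3)\<close>.\<close>

lemma line_product:
  assumes "l ^ 2 = x1 + x2 + x3" "a - 2 * l * c = x1 * x2 + x1 * x3 + x2 * x3"
    "b - c ^ 2 = - (x1 * x2 * x3)"
  shows "(cy - K l * cx - K c) * (cy + K l * cx + K c) = (cx - K x1) * (cx - K x2) * (cx - K x3)"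
proof -
  have eqs: "K l * K l = K x1 + K x2 + K x3" "K a - 2 * K l * K c = K x1 * K x2 + K x1 * K x3 + K x2 * K x3"
    "K b - K c * K c = - (K x1 * K x2 * K x3)"
    using arg_cong[OF assms(1), of K] arg_cong[OF assms(2), of K] arg_cong[OF assms(3), of K]
    by (simp_all add: power2_eq_square flip: fls_plus_const fls_minus_const fls_const_mult_const)
  have "(cy - K l * cx - K c) * (cy + K l * cx + K c) - (cx - K x1) * (cx - K x2) * (cx - K x3)
      = (cy * cy - (cx * cx * cx + K a * cx + K b)) - cx * cx * (K l * K l - (K x1 + K x2 + K x3))
        + cx * (K a - 2 * K l * K c - (K x1 * K x2 + K x1 * K x3 + K x2 * K x3))
        + (K b - K c * K c - (- (K x1 * K x2 * K x3)))"
    by (simp add: algebra_simps)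
  then show ?thesis
    unfolding eqs cy_mult_cy by simp
qed

text \<open>Divisor picture on the affine curve: the line cuts out P1 + P2 + P3 and the vertical
  line P3 + (-P3), so P1, P2 and the vertical line together amount to the line and -P3.\<close>

lemma line_below:
  assumes "l ^ 2 = x1 + x2 + x3" "a - 2 * l * c = x1 * x2 + x1 * x3 + x2 * x3"
    "b - c ^ 2 = - (x1 * x2 * x3)"
    and y: "y1 = l * x1 + c" "y2 = l * x2 + c" "y3 = l * x3 + c"
  shows "G x1 y1 * G x2 y2 * {cx - K x3} \<sqsubseteq> {cy - K l * cx - K c} * G x3 (- y3)"
proof -
  define L where "L = cy - K l * cx - K c"
  define v1 v2 v3 where v: "v1 = cx - K x1" "v2 = cx - K x2" "v3 = cx - K x3"
  define k where "k = K l"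
  have R: "L \<in> coord_ring" "v1 \<in> coord_ring" "v2 \<in> coord_ring" "v3 \<in> coord_ring" "k \<in> coord_ring"
    unfolding L_def v k_def by (intro ring_intros)+
  \<comment> \<open>As the line passes through the points, y - y1 and y - y2 differ from it by the
    slope times x - x1 and x - x2. Every generator on the left thus becomes a polynomial in
    \<open>L\<close>, \<open>k\<close> and the \<open>v\<close>'s.\<close>
  have e: "cy - K y1 = L + k * v1" "cy - K y2 = L + k * v2" "cy - K (- y3) = (cy + K l * cx + K c) - k * v3"
    unfolding y L_def v k_def fls_const_uminus fls_plus_const[symmetric] fls_const_mult_const[symmetric]
    by (simp_all add: algebra_simps del: fls_const_mult_const)
  \<comment> \<open>The conjugate line is expressed by the two generators of the ideal of -P3. Each
    product below splits into multiples of \<open>L * v3\<close> and of this one.\<close>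
  have prod: "v1 * v2 * v3 = L * ((cy - K (- y3)) + k * v3)"
    using line_product[OF assms(1-3)] unfolding e L_def v by simp
  have "G x1 y1 * G x2 y2 * {v3} = {v1 * v2 * v3, v1 * (L + k * v2) * v3, (L + k * v1) * v2 * v3,
     (L + k * v1) * (L + k * v2) * v3}"
    by (simp only: G_def pair_times_triple e v[symmetric])
  also have "\<dots> \<sqsubseteq> {L * v3, L * (cy - K (- y3))}"
    unfolding below_insert
  proof (intro conjI below_empty)
    show "v1 * v2 * v3 \<in> ideal_gen {L * v3, L * (cy - K (- y3))}"
      unfolding prod by (rule ideal_gen_pairI[of "k" 1]) (simp_all add: R ring_intros algebra_simps)
    show "v1 * (L + k * v2) * v3 \<in> ideal_gen {L * v3, L * (cy - K (- y3))}"
    proof (rule ideal_gen_pairI[of "v1 + k * k" "k"])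
      have "v1 * (L + k * v2) * v3 = v1 * (L * v3) + k * (v1 * v2 * v3)"
        by (simp add: algebra_simps)
      then show "v1 * (L + k * v2) * v3 = (v1 + k * k) * (L * v3) + k * (L * (cy - K (- y3)))"
        unfolding prod by (simp add: algebra_simps)
    qed (simp_all add: R ring_intros)
    show "(L + k * v1) * v2 * v3 \<in> ideal_gen {L * v3, L * (cy - K (- y3))}"
    proof (rule ideal_gen_pairI[of "v2 + k * k" "k"])
      have "(L + k * v1) * v2 * v3 = v2 * (L * v3) + k * (v1 * v2 * v3)"
        by (simp add: algebra_simps)
      then show "(L + k * v1) * v2 * v3 = (v2 + k * k) * (L * v3) + k * (L * (cy - K (- y3)))"
        unfolding prod by (simp add: algebra_simps)
    qed (simp_all add: R ring_intros)
    show "(L + k * v1) * (L + k * v2) * v3 \<in> ideal_gen {L * v3, L * (cy - K (- y3))}"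
    proof (rule ideal_gen_pairI[of "L + k * v1 + k * v2 + k * k * k" "k * k"])
      have "(L + k * v1) * (L + k * v2) * v3 = (L + k * v1 + k * v2) * (L * v3) + k * k * (v1 * v2 * v3)"
        by (simp add: algebra_simps)
      then show "(L + k * v1) * (L + k * v2) * v3 = (L + k * v1 + k * v2 + k * k * k) * (L * v3) + k * k * (L * (cy - K (- y3)))"
        unfolding prod by (simp add: algebra_simps)
    qed (simp_all add: R ring_intros)
  qed
  also have "{L * v3, L * (cy - K (- y3))} = {L} * G x3 (- y3)"
    by (simp add: G_def singleton_times_pair v)
  finally show ?thesis
    unfolding L_def v .
qed

lemma opposite_factor:
  assumes "y ^ 2 = x ^ 3 + a * x + b"
  shows "(cy - K y) * (cy - K (- y)) = (cx - K x) * (cx * cx + K x * cx + K x * K x + K a)"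
proof -
  have "K y * K y = K x * K x * K x + K a * K x + K b"
    using arg_cong[OF assms, of K]
    by (simp add: power2_eq_square power3_eq_cube flip: fls_plus_const fls_const_mult_const)
  then have "(cy - K y) * (cy - K (- y)) = (cx * cx * cx + K a * cx + K b) - (K x * K x * K x + K a * K x + K b)"
    unfolding cy_mult_cy[symmetric] by (simp add: fls_const_uminus algebra_simps)
  then show ?thesis
    by (simp add: algebra_simps)
qed

lemma opposite_below:
  assumes "y ^ 2 = x ^ 3 + a * x + b"
  shows "G x y * G x (- y) \<sqsubseteq> {cx - K x}"
proof -
  have *: "r * (cx - K x) \<in> ideal_gen {cx - K x}" "(cx - K x) * r \<in> ideal_gen {cx - K x}"
    if "r \<in> coord_ring" for r
    using ideal_gen_mult[OF that, of "cx - K x"] by (simp_all add: mult.commute)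
  show ?thesis
    unfolding G_product opposite_factor[OF assms] below_insert
    by (intro conjI below_empty * ring_intros)
qed

text \<open>Converse of \<open>opposite_below\<close>: it makes the ideal of a point invertible.
  This fails at a singular point, and \<open>nonsingular\<close> enters here.\<close>

lemma vertical_below:
  assumes "y ^ 2 = x ^ 3 + a * x + b"
  shows "{cx - K x} \<sqsubseteq> G x y * G x (- y)"
proof -
  define v where "v = cx - K x"
  have mem: "v * v \<in> ideal_gen (G x y * G x (- y))" "v * (cy - K (- y)) \<in> ideal_gen (G x y * G x (- y))"
    "(cy - K y) * v \<in> ideal_gen (G x y * G x (- y))"
    "v * (cx * cx + K x * cx + K x * K x + K a) \<in> ideal_gen (G x y * G x (- y))"
    unfolding v_def opposite_factor[OF assms, symmetric] G_product
    by (rule ideal_gen_base, simp only: insert_iff simp_thms)+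
  have "v \<in> ideal_gen (G x y * G x (- y))"
  proof (cases "y = 0")
    case False
    \<comment> \<open>The two mixed products differ by \<open>2 * y\<close> times
      \<open>v\<close>.\<close>
    let ?c = "K (1 / (2 * y))"
    have K2: "K (2 * y) = K y + K y"
      by (simp only: mult_2 fls_plus_const)
    have "?c * (v * (cy - K (- y))) + (- ?c) * ((cy - K y) * v) = (?c * K (2 * y)) * v"
      unfolding K2 fls_const_uminus by (simp add: algebra_simps del: fls_const_mult_const)
    also have "?c * K (2 * y) = 1"
      using False by (simp add: fls_const_mult_const)
    finally have "v = ?c * (v * (cy - K (- y))) + (- ?c) * ((cy - K y) * v)"
      by (simp only: mult_1_left)
    also have "\<dots> \<in> ideal_gen (G x y * G x (- y))"
      by (intro ideal_gen_add ideal_gen_scale mem ring_intros)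
    finally show ?thesis .
  next
    case True
    \<comment> \<open>At a point of order two, \<open>d\<close> is the derivative of the cubic,
      nonzero because the cubic has no double root. The quadratic cofactor equals
      \<open>(cx + 2 * K x) * (cx - K x) + K d\<close>, so its product with \<open>v\<close> is
      \<open>K d * v\<close> modulo \<open>v * v\<close>.\<close>
    define d where "d = 3 * x ^ 2 + a"
    have "d \<noteq> 0"
    proof
      assume "d = 0"
      then have "a = - 3 * x ^ 2"
        by (simp add: d_def eq_neg_iff_add_eq_0 add.commute)
      moreover from this assms True have "b = 2 * x ^ 3"
        by (simp add: power2_eq_square power3_eq_cube)
      ultimately show False
        using nonsingular by (simp add: power2_eq_square power3_eq_cube algebra_simps)
    qed
    let ?c = "K (1 / d)"
    have Kd: "K d = 3 * (K x * K x) + K a"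
      by (simp add: d_def power2_eq_square flip: fls_plus_const fls_const_mult_const)
    have "?c * (v * (cx * cx + K x * cx + K x * K x + K a)) + (- ?c * (cx + 2 * K x)) * (v * v)
        = ?c * (cx * cx + K x * cx + K x * K x + K a - (cx + 2 * K x) * (cx - K x)) * v"
      unfolding v_def by (simp add: algebra_simps del: fls_const_mult_const)
    also have "cx * cx + K x * cx + K x * K x + K a - (cx + 2 * K x) * (cx - K x) = K d"
      unfolding Kd by (simp add: algebra_simps)
    finally have "?c * (v * (cx * cx + K x * cx + K x * K x + K a)) + (- ?c * (cx + 2 * K x)) * (v * v)
        = (?c * K d) * v" .
    also have "?c * K d = 1"
      using \<open>d \<noteq> 0\<close> by (simp add: fls_const_mult_const)
    finally have "v = ?c * (v * (cx * cx + K x * cx + K x * K x + K a)) + (- ?c * (cx + 2 * K x)) * (v * v)"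
      by (simp only: mult_1_left)
    also have "\<dots> \<in> ideal_gen (G x y * G x (- y))"
      by (intro ideal_gen_add ideal_gen_scale mem ring_intros)
    finally show ?thesis .
  qed
  then show ?thesis by (simp add: v_def)
qed

lemma subdegree_vertical: "fls_subdegree (cx - K x) = -2"
  by (subst fls_subdegree_diff_eq1) (simp_all add: cx_nonzero subdegree_cx)

lemma subdegree_line: "fls_subdegree (cy - K l * cx - K c) = -3"
proof -
  have "fls_subdegree (cy - (K l * cx + K c)) = -3"
  proof (cases "l = 0")
    case True
    then show ?thesis
      by (subst fls_subdegree_diff_eq1) (simp_all add: cy_nonzero subdegree_cy)
  next
    case False
    have lx: "fls_subdegree (K l * cx) = -2" "K l * cx \<noteq> 0"
      using False by (simp_all add: cx_nonzero subdegree_cx)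
    have "fls_subdegree (K l * cx + K c) = -2"
      by (subst fls_subdegree_add_eq1) (use lx in auto)
    then show ?thesis
      by (subst fls_subdegree_diff_eq1) (simp_all add: cy_nonzero subdegree_cy)
  qed
  then show ?thesis by (simp add: algebra_simps)
qed

text \<open>The conjugate line is multiplied in and cancelled at the end. The product of the two
  lines is that of three vertical lines; those at \<open>x2\<close> and \<open>x3\<close> split by
  \<open>vertical_below\<close>, and the remaining factors are treated by \<open>line_below\<close>
  for the reflected line of slope \<open>- l\<close> and intercept \<open>- c\<close> through -P3,
  -P2 and -P1.\<close>

lemma below_line:
  assumes l: "l ^ 2 = x1 + x2 + x3" "a - 2 * l * c = x1 * x2 + x1 * x3 + x2 * x3"
    "b - c ^ 2 = - (x1 * x2 * x3)"
    and y: "y1 = l * x1 + c" "y2 = l * x2 + c" "y3 = l * x3 + c"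
    and P: "y2 ^ 2 = x2 ^ 3 + a * x2 + b" "y3 ^ 2 = x3 ^ 3 + a * x3 + b"
  shows "{cy - K l * cx - K c} \<sqsubseteq> G x1 y1 * G x2 y2 * G x3 y3"
proof -
  define L L' where L: "L = cy - K l * cx - K c" "L' = cy + K l * cx + K c"
  define v1 v2 v3 where v: "v1 = cx - K x1" "v2 = cx - K x2" "v3 = cx - K x3"
  have "{L'} * {L} = {v3} * ({v2} * {v1})"
    using line_product[OF l] by (simp add: singleton_times L v mult_ac)
  also have "\<dots> \<sqsubseteq> (G x3 y3 * G x3 (- y3)) * ((G x2 y2 * G x2 (- y2)) * {v1})"
    unfolding v by (intro below_mult vertical_below below_refl P)
  also have "\<dots> = (G x2 y2 * G x3 y3) * (G x3 (- y3) * G x2 (- y2) * {v1})"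
    by (simp only: mult_ac)
  also have "\<dots> \<sqsubseteq> (G x2 y2 * G x3 y3) * ({cy - K (- l) * cx - K (- c)} * G x1 (- (- y1)))"
    unfolding v by (intro below_mult_left line_below) (use l y in \<open>auto simp: algebra_simps\<close>)
  also have "\<dots> = {L'} * (G x1 y1 * G x2 y2 * G x3 y3)"
    by (simp add: L fls_const_uminus) (simp only: mult_ac)
  finally show ?thesis
    unfolding L(1)[symmetric]
  proof (rule below_cancel[rotated])
    have "L' = cy - K (- l) * cx - K (- c)" by (simp add: L fls_const_uminus)
    then show "L' \<noteq> 0" using subdegree_line[of "- l" "- c"] by auto
  qed
qed

section \<open>Lines attached to a sum of two points\<close>

fun gens :: "qbar ec_point \<Rightarrow> qbar fls set" where
  "gens Infinity = 1"
| "gens (Affine x y) = G x y"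

fun vert :: "qbar ec_point \<Rightarrow> qbar fls" where
  "vert Infinity = 1"
| "vert (Affine x y) = cx - K x"

text \<open>Number of affine points. Since infinity receives the unit ideal, the function 1 and
  weight 0, pole orders are sums of weights in all degenerate cases too.\<close>

fun weight :: "qbar ec_point \<Rightarrow> int" where
  "weight Infinity = 0"
| "weight (Affine x y) = 1"

lemma ec_neg_neg [simp]: "ec_neg (ec_neg P) = P"
  by (cases P) auto

lemma on_curve_neg: "on_curve (a, b) P \<Longrightarrow> on_curve (a, b) (ec_neg P)"
  by (cases P) auto

lemma ec_add_Infinity_right [simp]: "ec_add (a, b) P Infinity = P"
  by (cases P) auto

lemma vert_below: "on_curve (a, b) P \<Longrightarrow> {vert P} \<sqsubseteq> gens P * gens (ec_neg P)"
  using vertical_below by (cases P) (auto simp: set_one intro: ideal_gen_base)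

lemma below_vert: "on_curve (a, b) P \<Longrightarrow> gens P * gens (ec_neg P) \<sqsubseteq> {vert P}"
  using opposite_below by (cases P) (auto simp: set_one intro: ideal_gen_base)

lemma subdegree_vert: "fls_subdegree (vert P) = - 2 * weight P"
  by (cases P) (auto simp: subdegree_vertical)

lemma vert_nonzero: "vert P \<noteq> 0"
proof (cases P)
  case (Affine x y)
  then show ?thesis using subdegree_vertical[of x] by (metis fls_zero_subdegree vert.simps(2) zero_neq_neg_numeral)
qed simp

lemma gens_in_ring: "gens P \<subseteq> coord_ring"
  by (cases P) (auto simp: G_def set_one intro!: ring_intros)

text \<open>Vieta's formulas for t^3 + a t + b - (l t + c)^2. The choice of \<open>x3\<close>
  settles the sum of the roots, the linear coefficient depends on tangent or chord, and the constant
  one follows by evaluating at \<open>x1\<close>.\<close>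

lemma chord_line:
  assumes 1: "y1 ^ 2 = x1 ^ 3 + a * x1 + b" and 2: "y2 ^ 2 = x2 ^ 3 + a * x2 + b"
    and ne: "\<not> (x1 = x2 \<and> y1 = - y2)"
    and l: "l = (if x1 = x2 then (3 * x1 ^ 2 + a) / (2 * y1) else (y2 - y1) / (x2 - x1))"
    and x3: "x3 = l ^ 2 - x1 - x2" and c: "c = y1 - l * x1"
  shows "l ^ 2 = x1 + x2 + x3" "a - 2 * l * c = x1 * x2 + x1 * x3 + x2 * x3"
    "b - c ^ 2 = - (x1 * x2 * x3)" "y2 = l * x2 + c"
proof -
  show "l ^ 2 = x1 + x2 + x3" using x3 by simp
  have "y2 = l * x2 + c \<and> a - 2 * l * c = x1 * x2 + x1 * x3 + x2 * x3"
  proof (cases "x1 = x2")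
    case True
    have "(y1 - y2) * (y1 + y2) = 0"
      using 1 2 True by (simp add: algebra_simps power2_eq_square)
    with ne True have y: "y1 = y2"
      by (auto simp: eq_neg_iff_add_eq_0)
    with ne True have "y1 \<noteq> 0" by auto
    then have "2 * y1 * l = 3 * x1 ^ 2 + a"
      using l True by simp
    then have "2 * y1 * l - (3 * x1 ^ 2 + a) = 0" by simp
    \<comment> \<open>In the tangent case the linear coefficient is right exactly because the slope
      satisfies 2 y l = 3 x^2 + a, that is, because \<open>x1\<close> is a double root.\<close>
    moreover have "a - 2 * l * c - (x1 * x2 + x1 * x3 + x2 * x3) = - (2 * y1 * l - (3 * x1 ^ 2 + a))"
      unfolding c x3 True[symmetric] by (simp add: algebra_simps power2_eq_square)
    ultimately have "a - 2 * l * c = x1 * x2 + x1 * x3 + x2 * x3"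
      by simp
    then show ?thesis
      using True y c by simp
  next
    case False
    have l': "l * (x2 - x1) = y2 - y1" using l False by simp
    then have y: "y2 = l * x2 + c" unfolding c by (simp add: algebra_simps)
    \<comment> \<open>The difference of the curve equations at the two points is divisible by
      \<open>x2 - x1\<close>, with the linear coefficient as quotient.\<close>
    have "(x2 - x1) * (a - 2 * l * c - (x1 * x2 + x1 * x3 + x2 * x3))
        = (y1 ^ 2 - (x1 ^ 3 + a * x1 + b)) - ((l * x2 + c) ^ 2 - (x2 ^ 3 + a * x2 + b))"
      unfolding c x3 by (simp add: algebra_simps power2_eq_square power3_eq_cube)
    also have "\<dots> = 0"
      using 1 2 y by simp
    finally show ?thesis using False y by simp
  qed
  then show "y2 = l * x2 + c" and m: "a - 2 * l * c = x1 * x2 + x1 * x3 + x2 * x3" by auto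
  show "b - c ^ 2 = - (x1 * x2 * x3)"
  proof -
    have "b - c ^ 2 - (- (x1 * x2 * x3)) = (x1 ^ 3 + a * x1 + b - y1 ^ 2)
        - x1 * (a - 2 * l * c - (x1 * x2 + x1 * x3 + x2 * x3))"
      unfolding c x3 by (simp add: algebra_simps power2_eq_square power3_eq_cube)
    with 1 m show ?thesis by (simp add: eq_neg_iff_add_eq_0)
  qed
qed

text \<open>\<open>L\<close> is the chord or tangent when all three points are affine; otherwise it
  is a vertical line, or 1 if both summands are infinity. For associativity, the first inclusion
  extracts the lines of one bracketing and the second bounds those of the other.\<close>

lemma ec_add_line:
  assumes P: "on_curve (a, b) P" and Q: "on_curve (a, b) Q"
  obtains L where "on_curve (a, b) (ec_add (a, b) P Q)"
    "gens P * gens Q * {vert (ec_add (a, b) P Q)} \<sqsubseteq> {L} * gens (ec_add (a, b) P Q)"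
    "{L} \<sqsubseteq> gens P * gens Q * gens (ec_neg (ec_add (a, b) P Q))"
    "L \<noteq> 0" "fls_subdegree L = - (weight P + weight Q + weight (ec_add (a, b) P Q))"
proof -
  have inf: "\<exists>L. gens P * {vert P} \<sqsubseteq> {L} * gens P \<and> {L} \<sqsubseteq> gens P * gens (ec_neg P)
      \<and> L \<noteq> 0 \<and> fls_subdegree L = - (2 * weight P)"
    if "on_curve (a, b) P" for P
    using that by (intro exI[of _ "vert P"])
      (auto simp: vert_nonzero subdegree_vert mult.commute[of "gens P" "{vert P}"] ideal_gen_base
            intro!: vert_below[unfolded below_insert, THEN conjunct1] below_refl)
  consider "P = Infinity" | "Q = Infinity"
    | x y where "P = Affine x y" "Q = Affine x (- y)"
    | x1 y1 x2 y2 where "P = Affine x1 y1" "Q = Affine x2 y2" "\<not> (x1 = x2 \<and> y1 = - y2)"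
    by (metis add.inverse_inverse ec_point.exhaust)
  then show ?thesis
  proof cases
    case 1
    then show ?thesis using inf[OF Q] that Q by auto
  next
    case 2
    then show ?thesis using inf[OF P] that P by auto
  next
    case (3 x y)
    then show ?thesis
      using that[of "vert P"] below_vert[OF P] vert_below[OF P] vert_nonzero[of P] subdegree_vert[of P]
      by (auto simp: singleton_times)
  next
    case (4 x1 y1 x2 y2)
    define l where "l = (if x1 = x2 then (3 * x1 ^ 2 + a) / (2 * y1) else (y2 - y1) / (x2 - x1))"
    define x3 where "x3 = l ^ 2 - x1 - x2"
    define c where "c = y1 - l * x1"
    define y3 where "y3 = l * x3 + c"
    have P': "y1 ^ 2 = x1 ^ 3 + a * x1 + b" and Q': "y2 ^ 2 = x2 ^ 3 + a * x2 + b"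
      using P Q 4 by auto
    note chord = chord_line[OF P' Q' 4(3) l_def x3_def c_def]
    have sum: "ec_add (a, b) P Q = Affine x3 (- y3)"
      using 4 by (simp add: Let_def flip: l_def x3_def) (simp add: y3_def c_def x3_def algebra_simps)
    have y1: "y1 = l * x1 + c" by (simp add: c_def)
    have S: "y3 ^ 2 = x3 ^ 3 + a * x3 + b"
    proof -
      have "y3 ^ 2 - (x3 ^ 3 + a * x3 + b) = x3 ^ 2 * (l ^ 2 - (x1 + x2 + x3))
          - x3 * (a - 2 * l * c - (x1 * x2 + x1 * x3 + x2 * x3)) - (b - c ^ 2 - (- (x1 * x2 * x3)))"
        unfolding y3_def by (simp add: algebra_simps power2_eq_square power3_eq_cube)
      with chord(1-3) show ?thesis by simp
    qed
    show ?thesis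
      by (rule that[of "cy - K l * cx - K c"])
         (use S subdegree_line[of l c] line_below[OF chord(1-3) y1 chord(4) y3_def]
            below_line[OF chord(1-3) y1 chord(4) y3_def Q' S] sum 4 in auto)
  qed
qed

lemma ec_add_closed: "on_curve (a, b) P \<Longrightarrow> on_curve (a, b) Q \<Longrightarrow> on_curve (a, b) (ec_add (a, b) P Q)"
  by (rule ec_add_line)

lemma ec_add_neg: "ec_add (a, b) P (ec_neg P) = Infinity" "ec_add (a, b) (ec_neg P) P = Infinity"
  by (cases P; simp)+

lemma ec_add_neg_eq_InfinityD: "ec_add (a, b) P (ec_neg Q) = Infinity \<Longrightarrow> P = Q"
  by (cases P; cases Q) (auto simp: Let_def split: if_splits)

theorem ec_add_assoc:
  assumes A: "on_curve (a, b) A" and B: "on_curve (a, b) B" and C: "on_curve (a, b) C"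
  shows "ec_add (a, b) (ec_add (a, b) A B) C = ec_add (a, b) A (ec_add (a, b) B C)"
proof (rule ec_add_neg_eq_InfinityD)
  define D E where DE: "D = ec_add (a, b) A B" "E = ec_add (a, b) B C"
  define U T where UT: "U = ec_add (a, b) D C" "T = ec_add (a, b) A E"
  \<comment> \<open>The difference of the two bracketings; the goal is that it has weight 0.\<close>
  define Z where "Z = ec_add (a, b) U (ec_neg T)"
  obtain l1 where l1: "on_curve (a, b) D" "gens A * gens B * {vert D} \<sqsubseteq> {l1} * gens D"
    "l1 \<noteq> 0" "fls_subdegree l1 = - (weight A + weight B + weight D)"
    unfolding DE by (rule ec_add_line[OF A B])
  obtain l2 where l2: "on_curve (a, b) U" "gens D * gens C * {vert U} \<sqsubseteq> {l2} * gens U"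
    "l2 \<noteq> 0" "fls_subdegree l2 = - (weight D + weight C + weight U)"
    unfolding UT by (rule ec_add_line[OF l1(1) C])
  obtain m1 where m1: "on_curve (a, b) E" "{m1} \<sqsubseteq> gens B * gens C * gens (ec_neg E)"
    "m1 \<noteq> 0" "fls_subdegree m1 = - (weight B + weight C + weight E)"
    unfolding DE by (rule ec_add_line[OF B C])
  obtain m2 where m2: "on_curve (a, b) T" "{m2} \<sqsubseteq> gens A * gens E * gens (ec_neg T)"
    "m2 \<noteq> 0" "fls_subdegree m2 = - (weight A + weight E + weight T)"
    unfolding UT by (rule ec_add_line[OF A m1(1)])
  obtain l3 where l3: "gens U * gens (ec_neg T) * {vert Z} \<sqsubseteq> {l3} * gens Z"
    "l3 \<noteq> 0" "fls_subdegree l3 = - (weight U + weight (ec_neg T) + weight Z)"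
    unfolding Z_def by (rule ec_add_line[OF l2(1) on_curve_neg[OF m2(1)]])
  have wT: "weight (ec_neg T) = weight T" by (cases T) auto
  let ?V = "{vert D} * {vert U} * {vert Z}"
  \<comment> \<open>The function in question is \<open>m1 * m2 * vert D * vert U * vert Z\<close>
    divided by \<open>l1 * l2 * l3 * vert E\<close>. The chain shows that it lies in the ideal of
    \<open>Z\<close>, so it has no poles at affine points.\<close>
  have "{m1} * {m2} * ?V \<sqsubseteq> (gens B * gens C * gens (ec_neg E)) * (gens A * gens E * gens (ec_neg T)) * ?V"
    by (intro below_mult m1 m2 below_refl)
  also have "\<dots> = (gens B * gens C * gens A * gens (ec_neg T) * ?V) * (gens E * gens (ec_neg E))"
    by (simp only: mult_ac)
  also have "\<dots> \<sqsubseteq> (gens B * gens C * gens A * gens (ec_neg T) * ?V) * {vert E}"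
    by (intro below_mult below_vert m1 below_refl)
  also have "\<dots> = (gens A * gens B * {vert D}) * (gens C * gens (ec_neg T) * {vert U} * {vert Z} * {vert E})"
    by (simp only: mult_ac)
  also have "\<dots> \<sqsubseteq> ({l1} * gens D) * (gens C * gens (ec_neg T) * {vert U} * {vert Z} * {vert E})"
    by (intro below_mult l1 below_refl)
  also have "\<dots> = (gens D * gens C * {vert U}) * ({l1} * gens (ec_neg T) * {vert Z} * {vert E})"
    by (simp only: mult_ac)
  also have "\<dots> \<sqsubseteq> ({l2} * gens U) * ({l1} * gens (ec_neg T) * {vert Z} * {vert E})"
    by (intro below_mult l2 below_refl)
  also have "\<dots> = (gens U * gens (ec_neg T) * {vert Z}) * ({l1} * {l2} * {vert E})"
    by (simp only: mult_ac)
  also have "\<dots> \<sqsubseteq> ({l3} * gens Z) * ({l1} * {l2} * {vert E})"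
    by (intro below_mult l3 below_refl)
  also have "\<dots> = {l1 * l2 * l3 * vert E} * gens Z"
    by (simp only: mult_ac singleton_times[symmetric])
  finally have "m1 * m2 * (vert D * vert U * vert Z) \<in> ideal_gen ({l1 * l2 * l3 * vert E} * gens Z)"
    by (simp add: singleton_times)
  then obtain k where k: "k \<in> ideal_gen (gens Z)"
    "m1 * m2 * (vert D * vert U * vert Z) = l1 * l2 * l3 * vert E * k"
    using ideal_gen_singleton_mult by blast
  have nz: "m1 * m2 * (vert D * vert U * vert Z) \<noteq> 0"
    using m1 m2 vert_nonzero by simp
  with k(2) have "k \<noteq> 0" by auto
  have "fls_subdegree (m1 * m2 * (vert D * vert U * vert Z)) = fls_subdegree (l1 * l2 * l3 * vert E * k)"
    using k(2) by simp
  \<comment> \<open>All other weights cancel: those of \<open>A\<close>, \<open>B\<close>,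
    \<open>C\<close> and \<open>T\<close> occur once on either side, those of \<open>D\<close>,
    \<open>E\<close> and \<open>U\<close> twice. A \<open>Z\<close> of weight 1 would leave a single
    simple pole.\<close>
  then have "fls_subdegree k = - weight Z"
    using l1 l2 l3 m1 m2 vert_nonzero \<open>k \<noteq> 0\<close> by (simp add: subdegree_vert wT)
  moreover have "fls_subdegree k \<noteq> -1"
    using subdegree_in_ring ideal_gen_in_ring[OF k(1) gens_in_ring] by blast
  ultimately show "ec_add (a, b) (ec_add (a, b) (ec_add (a, b) A B) C) (ec_neg (ec_add (a, b) A (ec_add (a, b) B C))) = Infinity"
    unfolding DE[symmetric] UT[symmetric] Z_def[symmetric] by (cases Z) auto
qed

end

lemma group_ec_group:
  assumes "elliptic E"
  shows "group (ec_group E)"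
proof -
  obtain a b where E: "E = (a, b)" by (cases E)
  interpret weierstrass a b using assms E by unfold_locales simp
  show ?thesis
  proof (rule groupI)
    fix P assume "P \<in> carrier (ec_group E)"
    then show "\<exists>Q \<in> carrier (ec_group E). Q \<otimes>\<^bsub>ec_group E\<^esub> P = \<one>\<^bsub>ec_group E\<^esub>"
      by (intro bexI[of _ "ec_neg P"]) (auto simp: ec_group_def E ec_add_neg on_curve_neg)
  qed (auto simp: ec_group_def E ec_add_closed ec_add_assoc)
qed

section \<open>Automorphisms of the algebraic closure\<close>

text \<open>Graph of a ring homomorphism on a subring containing the rationals. As a set of pairs it
  passes to unions of chains without gluing. The last clause yields single-valuedness by
  subtraction, and injectivity once inverses are available.\<close>

definition partial_hom :: "(qbar \<times> qbar) set \<Rightarrow> bool" where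
  "partial_hom S \<longleftrightarrow> (\<forall>c\<in>\<rat>. (c, c) \<in> S) \<and>
     (\<forall>a a' b b'. (a, a') \<in> S \<longrightarrow> (b, b') \<in> S \<longrightarrow> (a + b, a' + b') \<in> S \<and> (a * b, a' * b') \<in> S) \<and>
     (\<forall>b. (0, b) \<in> S \<longrightarrow> b = 0)"

definition coeffs_rel :: "(qbar \<times> qbar) set \<Rightarrow> qbar poly \<Rightarrow> qbar poly \<Rightarrow> bool" where
  "coeffs_rel S f f' \<longleftrightarrow> (\<forall>i. (coeff f i, coeff f' i) \<in> S)"

lemma coeffs_relD: "coeffs_rel S f f' \<Longrightarrow> (coeff f i, coeff f' i) \<in> S"
  by (simp add: coeffs_rel_def)

lemma partial_homD:
  assumes "partial_hom S"
  shows "c \<in> \<rat> \<Longrightarrow> (c, c) \<in> S"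
    and "(a, a') \<in> S \<Longrightarrow> (b, b') \<in> S \<Longrightarrow> (a + b, a' + b') \<in> S"
    and "(a, a') \<in> S \<Longrightarrow> (b, b') \<in> S \<Longrightarrow> (a * b, a' * b') \<in> S"
    and "(0, b) \<in> S \<Longrightarrow> b = 0"
  using assms unfolding partial_hom_def by blast+

lemma to_ac_in_Rats: "to_ac r \<in> \<rat>" for r :: rat
proof (cases r)
  case (Fract a b)
  then show ?thesis by (simp add: Fract_of_int_quotient)
qed

lemma qbar_algebraic:
  fixes x :: qbar
  obtains p where "p \<noteq> 0" "\<And>i. coeff p i \<in> \<rat>" "poly p x = 0"
proof -
  obtain q :: "rat poly" where q: "q \<noteq> 0" "poly (map_poly to_ac q) x = 0"
    using alg_closure_algebraic by blast
  show ?thesis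
    by (rule that[of "map_poly to_ac q"])
       (use q in \<open>auto simp: map_poly_eq_0_iff coeff_map_poly to_ac_in_Rats\<close>)
qed

definition extend :: "(qbar \<times> qbar) set \<Rightarrow> qbar \<Rightarrow> qbar \<Rightarrow> (qbar \<times> qbar) set" where
  "extend S \<alpha> \<beta> = {(poly f \<alpha>, poly f' \<beta>) | f f'. coeffs_rel S f f'}"

text \<open>A minimal polynomial of \<open>\<alpha>\<close> over the domain of \<open>S\<close>, not
  made monic, together with its coefficientwise image.\<close>

definition minimal_rel :: "(qbar \<times> qbar) set \<Rightarrow> qbar \<Rightarrow> qbar poly \<Rightarrow> qbar poly \<Rightarrow> bool" where
  "minimal_rel S \<alpha> p p' \<longleftrightarrow> p \<noteq> 0 \<and> coeffs_rel S p p' \<and> poly p \<alpha> = 0 \<and>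
     (\<forall>f f'. coeffs_rel S f f' \<longrightarrow> poly f \<alpha> = 0 \<longrightarrow> degree f < degree p \<longrightarrow> f = 0)"

context
  fixes S :: "(qbar \<times> qbar) set"
  assumes hom: "partial_hom S"
begin

lemma uminus_rel: "(a, a') \<in> S \<Longrightarrow> (- a, - a') \<in> S"
  using partial_homD(3)[OF hom partial_homD(1)[OF hom, of "-1"], of a a'] by simp

lemma diff_rel: "(a, a') \<in> S \<Longrightarrow> (b, b') \<in> S \<Longrightarrow> (a - b, a' - b') \<in> S"
  using partial_homD(2)[OF hom _ uminus_rel, of a a' b b'] by simp

lemma sum_rel: "finite A \<Longrightarrow> (\<And>i. i \<in> A \<Longrightarrow> (g i, g' i) \<in> S) \<Longrightarrow> (sum g A, sum g' A) \<in> S"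
  by (induction A rule: finite_induct) (simp_all add: partial_homD[OF hom])

lemma rel_unique: "(a, b) \<in> S \<Longrightarrow> (a, b') \<in> S \<Longrightarrow> b = b'"
  using diff_rel[of a b a b'] partial_homD(4)[OF hom] by fastforce

lemma poly_rel:
  assumes "coeffs_rel S f f'" "(a, b) \<in> S"
  shows "(poly f a, poly f' b) \<in> S"
  using assms
proof (induction f f' rule: poly_induct2)
  case (pCons c f c' f')
  have "(c, c') \<in> S" "coeffs_rel S f f'"
    using pCons.prems(1) coeffs_relD[of S "pCons c f" "pCons c' f'" 0]
      coeffs_relD[of S "pCons c f" "pCons c' f'" "Suc _"] by (auto simp: coeffs_rel_def)
  with pCons show ?case by (simp add: partial_homD[OF hom])
qed (simp add: partial_homD[OF hom])

text \<open>The domain is a field because its elements are algebraic: after powers of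
  \<open>a\<close> are cancelled from an annihilating rational polynomial, its constant term is
  nonzero and the inverse of \<open>a\<close> becomes a rational polynomial in
  \<open>a\<close>.\<close>

lemma inverse_rel:
  assumes "(a, a') \<in> S" "a \<noteq> 0"
  obtains b where "(inverse a, b) \<in> S"
proof -
  have *: "\<exists>q. (\<forall>i. coeff q i \<in> \<rat>) \<and> inverse a = poly q a"
    if "p \<noteq> 0" "\<And>i. coeff p i \<in> \<rat>" "poly p a = 0" for p
    using that
  proof (induction p)
    case (pCons c p)
    have p: "coeff p i \<in> \<rat>" for i
      using pCons.prems(2)[of "Suc i"] by simp
    have c: "c \<in> \<rat>"
      using pCons.prems(2)[of 0] by simp
    show ?case
    proof (cases "c = 0")
      case True
      then show ?thesis using pCons p assms(2) by auto
    next
      case False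
      have "inverse a = poly (smult (- inverse c) p) a"
        using pCons.prems(3) False assms(2) by (simp add: field_simps eq_neg_iff_add_eq_0)
      then show ?thesis
        using p c by (intro exI[of _ "smult (- inverse c) p"]) simp
    qed
  qed simp
  obtain p where "p \<noteq> 0" "\<And>i. coeff p i \<in> \<rat>" "poly p a = 0"
    using qbar_algebraic by blast
  from *[OF this] obtain q where "\<forall>i. coeff q i \<in> \<rat>" "inverse a = poly q a" by blast
  with poly_rel[of q q, OF _ assms(1)] that show ?thesis
    by (metis coeffs_rel_def partial_homD(1)[OF hom])
qed

text \<open>A nonzero \<open>a\<close> sent to 0 would, multiplied by its inverse, send 1 to
  0.\<close>

lemma rel_zero_right:
  assumes "(a, 0) \<in> S"
  shows "a = 0"
proof (rule ccontr)
  assume "a \<noteq> 0"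
  then obtain b where "(inverse a, b) \<in> S" using inverse_rel assms by blast
  with assms \<open>a \<noteq> 0\<close> have "(1, 0) \<in> S"
    using partial_homD(3)[OF hom assms] by fastforce
  then have "0 = (1 :: qbar)"
    by (rule rel_unique) (simp add: partial_homD(1)[OF hom])
  then show False by simp
qed

lemma coeffs_rel_coeff_eq_0_iff: "coeffs_rel S f f' \<Longrightarrow> coeff f i = 0 \<longleftrightarrow> coeff f' i = 0"
  using rel_zero_right partial_homD(4)[OF hom] by (metis coeffs_rel_def)

lemma coeffs_rel_degree: "coeffs_rel S f f' \<Longrightarrow> degree f = degree f'"
  by (simp add: degree_def coeffs_rel_coeff_eq_0_iff)

lemma coeffs_rel_eq_0_iff: "coeffs_rel S f f' \<Longrightarrow> f = 0 \<longleftrightarrow> f' = 0"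
  by (simp add: poly_eq_iff coeffs_rel_coeff_eq_0_iff)

lemma coeffs_rel_add: "coeffs_rel S f f' \<Longrightarrow> coeffs_rel S g g' \<Longrightarrow> coeffs_rel S (f + g) (f' + g')"
  by (simp add: coeffs_rel_def partial_homD[OF hom])

lemma coeffs_rel_diff: "coeffs_rel S f f' \<Longrightarrow> coeffs_rel S g g' \<Longrightarrow> coeffs_rel S (f - g) (f' - g')"
  by (simp add: coeffs_rel_def diff_rel)

lemma coeffs_rel_mult: "coeffs_rel S f f' \<Longrightarrow> coeffs_rel S g g' \<Longrightarrow> coeffs_rel S (f * g) (f' * g')"
  by (auto simp: coeffs_rel_def coeff_mult intro!: sum_rel partial_homD(3)[OF hom])

lemma coeffs_rel_monom: "(c, c') \<in> S \<Longrightarrow> coeffs_rel S (monom c n) (monom c' n)"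
  by (simp add: coeffs_rel_def partial_homD[OF hom])

lemma minimal_rel_exists:
  obtains p p' where "minimal_rel S \<alpha> p p'"
proof -
  define Q where "Q = (\<lambda>(p, p'). p \<noteq> 0 \<and> coeffs_rel S p p' \<and> poly p \<alpha> = 0)"
  obtain p0 where "p0 \<noteq> 0" "\<And>i. coeff p0 i \<in> \<rat>" "poly p0 \<alpha> = 0"
    using qbar_algebraic by blast
  then have "Q (p0, p0)"
    by (simp add: Q_def coeffs_rel_def partial_homD(1)[OF hom])
  from ex_has_least_nat[of Q, OF this, of "\<lambda>z. degree (fst z)"]
  obtain z where "Q z" "\<And>y. Q y \<Longrightarrow> degree (fst z) \<le> degree (fst y)" by blast
  then have "minimal_rel S \<alpha> (fst z) (snd z)"
    unfolding minimal_rel_def Q_def by (fastforce simp: case_prod_beta not_less)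
  then show ?thesis by (rule that)
qed

lemma minimal_rel_degree: "minimal_rel S \<alpha> p p' \<Longrightarrow> degree p > 0"
  by (rule ccontr) (auto simp: minimal_rel_def elim!: degree_eq_zeroE)

text \<open>This makes f(\<open>\<alpha>\<close>) -> f'(\<open>\<beta>\<close>) well defined.
  Division by \<open>p\<close> is carried out on \<open>f\<close> and in parallel on
  \<open>f'\<close>, removing one leading term at a time, until minimality of \<open>p\<close>
  forces the rest to vanish.\<close>

lemma minimal_rel_root:
  assumes "minimal_rel S \<alpha> p p'" "poly p' \<beta> = 0" "coeffs_rel S f f'" "poly f \<alpha> = 0"
  shows "poly f' \<beta> = 0"
  using assms(3,4)
proof (induction "degree f" arbitrary: f f' rule: less_induct)
  case less
  note p = assms(1)[unfolded minimal_rel_def]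
  show ?case
  proof (cases "f = 0")
    case True
    with coeffs_rel_eq_0_iff[OF less.prems(1)] show ?thesis by simp
  next
    case False
    have deg: "degree f > 0"
      using less.prems False by (intro gr0I) (auto elim!: degree_eq_zeroE)
    have le: "degree p \<le> degree f"
      using p less.prems False by (meson not_less)
    define k where "k = degree f - degree p"
    obtain u where u: "(inverse (lead_coeff p), u) \<in> S"
      using inverse_rel[of "lead_coeff p"] p coeffs_relD[of S p p'] by (metis leading_coeff_0_iff)
    define c c' where "c = lead_coeff f * inverse (lead_coeff p)" and "c' = coeff f' (degree f) * u"
    have c: "(c, c') \<in> S"
      unfolding c_def c'_def using partial_homD(3)[OF hom coeffs_relD[OF less.prems(1)] u] .
    define g g' where "g = f - monom c k * p" and "g' = f' - monom c' k * p'"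
    have gg: "coeffs_rel S g g'"
      unfolding g_def g'_def using p c less.prems
      by (intro coeffs_rel_diff coeffs_rel_mult coeffs_rel_monom) auto
    have "degree g < degree f"
    proof (rule degree_lessI)
      show "\<forall>n\<ge>degree f. coeff g n = 0"
      proof (intro allI impI)
        fix n assume n: "n \<ge> degree f"
        show "coeff g n = 0"
        proof (cases "n = degree f")
          case True
          then show ?thesis
            using le p by (simp add: g_def coeff_monom_mult k_def c_def)
        next
          case False
          with n le show ?thesis
            by (simp add: g_def coeff_monom_mult k_def coeff_eq_0)
        qed
      qed
    qed (use deg in simp)
    moreover have "poly g \<alpha> = 0"
      using p less.prems by (simp add: g_def)
    ultimately have "poly g' \<beta> = 0"
      using less.hyps gg by blast
    then show ?thesis
      using assms(2) by (simp add: g'_def)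
  qed
qed

lemma partial_hom_extend:
  assumes "minimal_rel S \<alpha> p p'" "poly p' \<beta> = 0"
  shows "partial_hom (extend S \<alpha> \<beta>)" and "S \<subseteq> extend S \<alpha> \<beta>" and "(\<alpha>, \<beta>) \<in> extend S \<alpha> \<beta>"
proof -
  show sub: "S \<subseteq> extend S \<alpha> \<beta>"
  proof (clarify)
    fix a b assume "(a, b) \<in> S"
    then have "coeffs_rel S [:a:] [:b:]"
      using coeffs_rel_monom[of a b 0] by (simp add: monom_0)
    then show "(a, b) \<in> extend S \<alpha> \<beta>"
      unfolding extend_def by force
  qed
  have "coeffs_rel S [:0, 1:] [:0, 1:]"
    using coeffs_rel_monom[of 1 1 1] partial_homD(1)[OF hom, of 1] by (simp add: monom_altdef)
  then show "(\<alpha>, \<beta>) \<in> extend S \<alpha> \<beta>"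
    unfolding extend_def by force
  show "partial_hom (extend S \<alpha> \<beta>)"
    unfolding partial_hom_def
  proof (intro conjI allI impI ballI)
    fix c :: qbar assume "c \<in> \<rat>"
    then show "(c, c) \<in> extend S \<alpha> \<beta>"
      using sub partial_homD(1)[OF hom] by blast
  next
    fix a a' b b' assume "(a, a') \<in> extend S \<alpha> \<beta>" "(b, b') \<in> extend S \<alpha> \<beta>"
    then obtain f f' g g' where fg: "coeffs_rel S f f'" "coeffs_rel S g g'"
      "a = poly f \<alpha>" "a' = poly f' \<beta>" "b = poly g \<alpha>" "b' = poly g' \<beta>"
      unfolding extend_def by blast
    show "(a + b, a' + b') \<in> extend S \<alpha> \<beta>"
      unfolding extend_def fg by (rule CollectI, rule exI[of _ "f + g"], rule exI[of _ "f' + g'"]) (simp add: coeffs_rel_add fg)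
    show "(a * b, a' * b') \<in> extend S \<alpha> \<beta>"
      unfolding extend_def fg by (rule CollectI, rule exI[of _ "f * g"], rule exI[of _ "f' * g'"]) (simp add: coeffs_rel_mult fg)
  next
    fix b assume "(0, b) \<in> extend S \<alpha> \<beta>"
    then show "b = 0"
      unfolding extend_def using minimal_rel_root[OF assms] by force
  qed
qed

end

lemma partial_hom_Union_chain:
  assumes "\<C> \<noteq> {}" "subset.chain {S. partial_hom S \<and> S\<^sub>0 \<subseteq> S} \<C>"
  shows "partial_hom (\<Union>\<C>)"
proof -
  have mem: "partial_hom S" if "S \<in> \<C>" for S
    using assms(2) that by (auto simp: subset.chain_def)
  have two: "\<exists>S\<in>\<C>. z \<in> S \<and> w \<in> S" if zw: "z \<in> \<Union>\<C>" "w \<in> \<Union>\<C>" for z w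
  proof -
    obtain S where "S \<in> \<C>" "z \<in> S" using zw(1) by (rule UnionE)
    moreover obtain T where "T \<in> \<C>" "w \<in> T" using zw(2) by (rule UnionE)
    moreover have "S \<subseteq> T \<or> T \<subseteq> S"
      using subset.chain_total[OF assms(2)] calculation by blast
    ultimately show ?thesis by blast
  qed
  show ?thesis
    unfolding partial_hom_def
  proof (intro conjI allI impI ballI)
    fix c :: qbar assume "c \<in> \<rat>"
    then show "(c, c) \<in> \<Union>\<C>"
      using assms(1) mem partial_homD(1) by blast
  next
    fix a a' b b' assume "(a, a') \<in> \<Union>\<C>" "(b, b') \<in> \<Union>\<C>"
    from two[OF this] mem show "(a + b, a' + b') \<in> \<Union>\<C>" "(a * b, a' * b') \<in> \<Union>\<C>"
      using partial_homD(2,3) by (meson UnionI)+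
  next
    fix b assume "(0, b) \<in> \<Union>\<C>"
    then show "b = 0"
      using mem partial_homD(4) by blast
  qed
qed

text \<open>A maximal extension is total, since the image of a minimal polynomial has a root in the
  algebraically closed field and so permits one more step.\<close>

theorem partial_hom_extends_to_gal:
  assumes "partial_hom S\<^sub>0"
  obtains \<sigma> where "\<sigma> \<in> gal_Q" "\<And>a b. (a, b) \<in> S\<^sub>0 \<Longrightarrow> \<sigma> a = b"
proof -
  obtain M where M: "partial_hom M" "S\<^sub>0 \<subseteq> M" and max: "\<And>S. partial_hom S \<Longrightarrow> M \<subseteq> S \<Longrightarrow> S = M"
  proof -
    have "\<exists>M\<in>{S. partial_hom S \<and> S\<^sub>0 \<subseteq> S}. \<forall>S\<in>{S. partial_hom S \<and> S\<^sub>0 \<subseteq> S}. M \<subseteq> S \<longrightarrow> S = M"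
    proof (rule subset_Zorn_nonempty)
      show "{S. partial_hom S \<and> S\<^sub>0 \<subseteq> S} \<noteq> {}" using assms by blast
      fix \<C> assume C: "\<C> \<noteq> {}" "subset.chain {S. partial_hom S \<and> S\<^sub>0 \<subseteq> S} \<C>"
      then obtain S where "S \<in> \<C>" by blast
      moreover from this C(2) have "S\<^sub>0 \<subseteq> S" unfolding subset.chain_def by blast
      ultimately have "S\<^sub>0 \<subseteq> \<Union>\<C>" by blast
      with partial_hom_Union_chain[OF C] show "\<Union>\<C> \<in> {S. partial_hom S \<and> S\<^sub>0 \<subseteq> S}" by simp
    qed
    then obtain M where "M \<in> {S. partial_hom S \<and> S\<^sub>0 \<subseteq> S}"
      and "\<forall>S\<in>{S. partial_hom S \<and> S\<^sub>0 \<subseteq> S}. M \<subseteq> S \<longrightarrow> S = M" by (rule bexE)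
    with that[of M] show ?thesis by auto
  qed
  have total: "\<exists>b. (a, b) \<in> M" for a
  proof -
    obtain p p' where p: "minimal_rel M a p p'"
      using minimal_rel_exists[OF M(1)] .
    then have "degree p' > 0"
      using minimal_rel_degree[OF M(1) p] coeffs_rel_degree[OF M(1), of p p'] by (simp add: minimal_rel_def)
    then obtain b where "poly p' b = 0"
      using alg_closed_imp_poly_has_root by blast
    note ext = partial_hom_extend[OF M(1) p this]
    from max[OF ext(1,2)] ext(3) have "(a, b) \<in> M" by simp
    then show ?thesis ..
  qed
  define \<sigma> where "\<sigma> a = (SOME b. (a, b) \<in> M)" for a
  have \<sigma>: "(a, \<sigma> a) \<in> M" for a
    unfolding \<sigma>_def using total by (rule someI_ex)
  have \<sigma>_eq: "(a, b) \<in> M \<Longrightarrow> \<sigma> a = b" for a b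
    using rel_unique[OF M(1) \<sigma>] .
  have add: "\<sigma> (x + y) = \<sigma> x + \<sigma> y" and mult: "\<sigma> (x * y) = \<sigma> x * \<sigma> y" for x y
    by (rule \<sigma>_eq, rule partial_homD(2,3)[OF M(1) \<sigma> \<sigma>])+
  have inj: "inj \<sigma>"
  proof (rule injI)
    fix x y assume "\<sigma> x = \<sigma> y"
    then have "(x - y, 0) \<in> M"
      using diff_rel[OF M(1) \<sigma>[of x] \<sigma>[of y]] by simp
    from rel_zero_right[OF M(1) this] show "x = y" by simp
  qed
  \<comment> \<open>The finite root set of a rational polynomial killing \<open>b\<close> is mapped
    injectively into itself, hence onto itself.\<close>
  have "b \<in> range \<sigma>" for b
  proof -
    obtain f where f: "f \<noteq> 0" "\<And>i. coeff f i \<in> \<rat>" "poly f b = 0"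
      by (rule qbar_algebraic[of b]) blast
    have "(poly f x, poly f (\<sigma> x)) \<in> M" for x
      using f(2) by (intro poly_rel[OF M(1) _ \<sigma>]) (simp add: coeffs_rel_def partial_homD(1)[OF M(1)])
    then have "\<sigma> ` {x. poly f x = 0} \<subseteq> {x. poly f x = 0}"
      using partial_homD(4)[OF M(1)] by (metis (mono_tags) image_subsetI mem_Collect_eq)
    with poly_roots_finite[OF f(1)] have "\<sigma> ` {x. poly f x = 0} = {x. poly f x = 0}"
      using inj_on_subset[OF inj subset_UNIV] by (intro endo_inj_surj)
    with f(3) show ?thesis by blast
  qed
  with inj have "bij \<sigma>" by (auto simp: bij_def)
  with add mult have "\<sigma> \<in> gal_Q" by (simp add: gal_Q_def)
  then show ?thesis
    by (rule that) (use \<sigma>_eq M(2) in blast)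
qed

section \<open>Subfields as fixed fields\<close>

definition is_subfield :: "qbar set \<Rightarrow> bool" where
  "is_subfield L \<longleftrightarrow> 1 \<in> L \<and> (\<forall>x\<in>L. \<forall>y\<in>L. x + y \<in> L \<and> x * y \<in> L) \<and> (\<forall>x\<in>L. - x \<in> L \<and> inverse x \<in> L)"

lemma is_subfieldD:
  assumes "is_subfield L"
  shows "1 \<in> L" "x \<in> L \<Longrightarrow> y \<in> L \<Longrightarrow> x + y \<in> L" "x \<in> L \<Longrightarrow> y \<in> L \<Longrightarrow> x * y \<in> L"
    "x \<in> L \<Longrightarrow> - x \<in> L" "x \<in> L \<Longrightarrow> inverse x \<in> L"
  using assms unfolding is_subfield_def by blast+

lemma is_subfield_0: "is_subfield L \<Longrightarrow> 0 \<in> L"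
  using is_subfieldD(2)[of L 1 "-1"] is_subfieldD(1,4)[of L] by simp

lemma is_subfield_of_nat: "is_subfield L \<Longrightarrow> of_nat n \<in> L"
  by (induction n) (simp_all add: is_subfieldD is_subfield_0)

lemma is_subfield_of_int: "is_subfield L \<Longrightarrow> of_int n \<in> L"
  using is_subfield_of_nat[of L] by (cases n rule: int_cases2) (auto intro: is_subfieldD)

lemma is_subfield_Rats: "is_subfield L \<Longrightarrow> c \<in> \<rat> \<Longrightarrow> c \<in> L"
  by (elim Rats_cases') (simp only: divide_inverse is_subfieldD(3,5) is_subfield_of_int)

text \<open>The minimal polynomial of \<open>\<alpha>\<close> over \<open>L\<close> is not linear,
  as \<open>\<alpha>\<close> is outside \<open>L\<close>, and is separable. So
  \<open>\<alpha>\<close> has a second conjugate, and the identity of \<open>L\<close> extends to a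
  map sending \<open>\<alpha>\<close> there.\<close>

theorem separating_automorphism:
  assumes L: "is_subfield L" and \<alpha>: "\<alpha> \<notin> L"
  obtains \<sigma> where "\<sigma> \<in> gal_Q" "\<And>x. x \<in> L \<Longrightarrow> \<sigma> x = x" "\<sigma> \<alpha> \<noteq> \<alpha>"
proof -
  have hom: "partial_hom (Id_on L)"
    using is_subfieldD(2,3)[OF L] is_subfield_Rats[OF L] by (simp add: partial_hom_def Id_on_iff)
  obtain p p' where min: "minimal_rel (Id_on L) \<alpha> p p'"
    using minimal_rel_exists[OF hom] .
  then have "coeffs_rel (Id_on L) p p'" by (simp add: minimal_rel_def)
  from coeffs_relD[OF this] have pL: "coeff p i \<in> L \<and> coeff p i = coeff p' i" for i
    unfolding Id_on_iff by metis
  have "p \<noteq> 0" "poly p \<alpha> = 0"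
    using min by (simp_all add: minimal_rel_def)
  moreover have "coeff p i \<in> L" for i
    using pL by blast
  moreover have "p' = p"
    by (rule poly_eqI) (simp add: pL)
  ultimately have p: "p \<noteq> 0" "poly p \<alpha> = 0" "\<And>i. coeff p i \<in> L" "p' = p"
    by blast+
  have min': "f = 0" if "\<And>i. coeff f i \<in> L" "poly f \<alpha> = 0" "degree f < degree p" for f
  proof -
    have "coeffs_rel (Id_on L) f f" using that(1) by (simp add: coeffs_rel_def Id_on_iff)
    with min that(2,3) show ?thesis unfolding minimal_rel_def by blast
  qed
  obtain q where q: "p = [:- \<alpha>, 1:] * q"
    using p(2) by (auto simp: poly_eq_0_iff_dvd)
  have "q \<noteq> 0" using p(1) q by auto
  have "degree q \<noteq> 0"
  proof
    assume "degree q = 0"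
    then obtain c where c: "q = [:c:]" by (rule degree_eq_zeroE)
    then have "coeff p 1 = c" "coeff p 0 = - \<alpha> * c" by (simp_all add: q)
    then have "c \<in> L" "- \<alpha> * c \<in> L"
      using p(3)[of 1] p(3)[of 0] by auto
    then have "- (- \<alpha> * c) * inverse c \<in> L"
      using is_subfieldD(3)[OF L is_subfieldD(4)[OF L] is_subfieldD(5)[OF L]] by blast
    also have "- (- \<alpha> * c) * inverse c = \<alpha>"
      using \<open>q \<noteq> 0\<close> c by simp
    finally show False using \<alpha> by simp
  qed
  then obtain \<beta> where \<beta>: "poly q \<beta> = 0"
    using alg_closed_imp_poly_has_root[of q] by blast
  have "\<beta> \<noteq> \<alpha>"
  proof
    \<comment> \<open>A double root is a root of the derivative, which has coefficients in
      \<open>L\<close> and smaller degree, and is nonzero in characteristic 0.\<close>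
    assume "\<beta> = \<alpha>"
    then have "poly (pderiv p) \<alpha> = 0"
      using \<beta> by (simp add: q pderiv_mult del: mult_pCons_left)
    moreover have "coeff (pderiv p) i \<in> L" for i
      using p(3) by (simp add: coeff_pderiv is_subfieldD[OF L] is_subfield_of_nat[OF L] del: of_nat_Suc)
    moreover have "degree (pderiv p) < degree p"
      using minimal_rel_degree[OF hom min] by (simp add: degree_pderiv)
    ultimately have "pderiv p = 0" by (intro min')
    then show False
      using minimal_rel_degree[OF hom min] by (simp add: pderiv_eq_0_iff)
  qed
  have "poly p' \<beta> = 0" using \<beta> by (simp add: p(4) q)
  note ext = partial_hom_extend[OF hom min this]
  obtain \<sigma> where \<sigma>: "\<sigma> \<in> gal_Q" "\<And>a b. (a, b) \<in> extend (Id_on L) \<alpha> \<beta> \<Longrightarrow> \<sigma> a = b"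
    by (rule partial_hom_extends_to_gal[OF ext(1)]) blast
  show ?thesis
    by (rule that[OF \<sigma>(1)]) (use \<sigma>(2)[OF subsetD[OF ext(2)]] \<sigma>(2)[OF ext(3)] \<open>\<beta> \<noteq> \<alpha>\<close> in \<open>simp_all add: Id_on_iff\<close>)
qed

section \<open>Residue fields and their stabilizers\<close>

definition mono_eval :: "(nat \<Rightarrow>\<^sub>0 nat) \<Rightarrow> (nat \<Rightarrow> qbar) \<Rightarrow> qbar" where
  "mono_eval e v = (\<Prod>k \<in> Poly_Mapping.keys e. v k ^ Poly_Mapping.lookup e k)"

lemma mpol_eval_mono: "mpol_eval F v = (\<Sum>e \<in> Poly_Mapping.keys F. Poly_Mapping.lookup F e * mono_eval e v)"
  by (simp add: mpol_eval_def mono_eval_def)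

lemma mono_eval_superset:
  assumes "finite A" "Poly_Mapping.keys e \<subseteq> A"
  shows "mono_eval e v = (\<Prod>k \<in> A. v k ^ Poly_Mapping.lookup e k)"
  unfolding mono_eval_def
  by (rule prod.mono_neutral_left) (use assms in \<open>auto simp: in_keys_iff\<close>)

lemma mono_eval_add: "mono_eval (e + e') v = mono_eval e v * mono_eval e' v"
proof -
  let ?A = "Poly_Mapping.keys e \<union> Poly_Mapping.keys e'"
  have "mono_eval (e + e') v = (\<Prod>k \<in> ?A. v k ^ Poly_Mapping.lookup (e + e') k)"
    using keys_add[of e e'] by (intro mono_eval_superset) auto
  also have "\<dots> = (\<Prod>k \<in> ?A. v k ^ Poly_Mapping.lookup e k) * (\<Prod>k \<in> ?A. v k ^ Poly_Mapping.lookup e' k)"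
    by (simp add: lookup_add power_add prod.distrib)
  also have "\<dots> = mono_eval e v * mono_eval e' v"
    by (subst (1 2) mono_eval_superset[of ?A]) auto
  finally show ?thesis .
qed

lemma mpol_eval_0 [simp]: "mpol_eval 0 v = 0"
  by (simp add: mpol_eval_mono)

lemma mpol_eval_add: "mpol_eval (F + G) v = mpol_eval F v + mpol_eval G v"
  unfolding mpol_eval_mono
  by (rule setsum_keys_plus_distrib) (simp_all add: distrib_right)

lemma mpol_eval_sum: "mpol_eval (\<Sum>i\<in>A. H i) v = (\<Sum>i\<in>A. mpol_eval (H i) v)"
  by (induction A rule: infinite_finite_induct) (simp_all add: mpol_eval_add)

lemma mpol_eval_single: "mpol_eval (Poly_Mapping.single e c) v = c * mono_eval e v"
  by (simp add: mpol_eval_mono)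

lemma mpol_as_sum: "F = (\<Sum>e \<in> Poly_Mapping.keys F. Poly_Mapping.single e (Poly_Mapping.lookup F e))"
  for F :: mpol
  by (rule poly_mapping_eqI)
     (simp add: lookup_sum lookup_single when_def in_keys_iff)

text \<open>Unfolding the convolution into monomials gives both multiplicativity of evaluation and
  rationality of the coefficients of a product.\<close>

lemma mpol_mult_as_sum:
  "F * G = (\<Sum>e \<in> Poly_Mapping.keys F. \<Sum>e' \<in> Poly_Mapping.keys G.
     Poly_Mapping.single (e + e') (Poly_Mapping.lookup F e * Poly_Mapping.lookup G e'))"
  for F G :: mpol
  using arg_cong2[OF mpol_as_sum[of F] mpol_as_sum[of G], of "(*)"]
  by (simp only: sum_distrib_left sum_distrib_right mult_single) (rule sum.swap)

lemma mpol_eval_mult: "mpol_eval (F * G) v = mpol_eval F v * mpol_eval G v"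
  unfolding mpol_mult_as_sum
  by (simp add: mpol_eval_sum mpol_eval_single mpol_eval_mono[of F] mpol_eval_mono[of G] sum_product mono_eval_add mult_ac)

lemma rational_formD:
  assumes "rational_form m d F"
  shows "e \<in> Poly_Mapping.keys F \<Longrightarrow> Poly_Mapping.keys e \<subseteq> {..m}"
    and "e \<in> Poly_Mapping.keys F \<Longrightarrow> (\<Sum>k\<le>m. Poly_Mapping.lookup e k) = d"
    and "Poly_Mapping.lookup F e \<in> \<rat>"
  using assms unfolding rational_form_def hom_form_def by blast+

lemma rational_form_add:
  assumes "rational_form m d F" "rational_form m d G"
  shows "rational_form m d (F + G)"
  unfolding rational_form_def hom_form_def
proof (intro conjI ballI allI)
  fix e assume "e \<in> Poly_Mapping.keys (F + G)"
  then have "e \<in> Poly_Mapping.keys F \<or> e \<in> Poly_Mapping.keys G"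
    using keys_add[of F G] by blast
  then show "Poly_Mapping.keys e \<subseteq> {..m}" "(\<Sum>k\<le>m. Poly_Mapping.lookup e k) = d"
    using rational_formD(1,2)[OF assms(1)] rational_formD(1,2)[OF assms(2)] by blast+
next
  fix e show "Poly_Mapping.lookup (F + G) e \<in> \<rat>"
    by (simp add: lookup_add Rats_add rational_formD(3)[OF assms(1)] rational_formD(3)[OF assms(2)])
qed

lemma rational_form_mult:
  assumes F: "rational_form m d F" and G: "rational_form m d' G"
  shows "rational_form m (d + d') (F * G)"
  unfolding rational_form_def hom_form_def
proof (intro conjI ballI allI)
  fix e assume "e \<in> Poly_Mapping.keys (F * G)"
  then obtain f g where e: "e = f + g" "f \<in> Poly_Mapping.keys F" "g \<in> Poly_Mapping.keys G"
    using keys_mult[of F G] by blast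
  show "Poly_Mapping.keys e \<subseteq> {..m}"
    using keys_add[of f g] rational_formD(1)[OF F e(2)] rational_formD(1)[OF G e(3)] unfolding e(1) by blast
  show "(\<Sum>k\<le>m. Poly_Mapping.lookup e k) = d + d'"
    using rational_formD(2)[OF F e(2)] rational_formD(2)[OF G e(3)]
    by (simp add: e(1) lookup_add sum.distrib)
next
  fix e
  show "Poly_Mapping.lookup (F * G) e \<in> \<rat>"
    unfolding mpol_mult_as_sum lookup_sum
    by (intro Rats_sum) (simp add: lookup_single when_def rational_formD(3)[OF F] rational_formD(3)[OF G])
qed

lemma rational_form_const: "c \<in> \<rat> \<Longrightarrow> rational_form m 0 (Poly_Mapping.single 0 c)"
  by (simp add: rational_form_def hom_form_def lookup_single when_def)

lemma mpol_eval_const: "mpol_eval (Poly_Mapping.single 0 c) v = c"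
  by (simp add: mpol_eval_single mono_eval_def)

lemma rational_form_var:
  assumes "i \<le> m"
  shows "rational_form m 1 (Poly_Mapping.single (Poly_Mapping.single i 1) 1)"
  using assms by (simp add: rational_form_def hom_form_def lookup_single when_def)

lemma mpol_eval_var: "mpol_eval (Poly_Mapping.single (Poly_Mapping.single i 1) 1) v = v i"
  by (simp add: mpol_eval_single mono_eval_def)

lemma mpol_eval_scale:
  assumes "rational_form m d F"
  shows "mpol_eval F (\<lambda>i. c * v i) = c ^ d * mpol_eval F v"
proof -
  have "mono_eval e (\<lambda>i. c * v i) = c ^ d * mono_eval e v" if e: "e \<in> Poly_Mapping.keys F" for e
    using rational_formD(2)[OF assms e, symmetric]
    by (simp add: mono_eval_superset[OF _ rational_formD(1)[OF assms e]] power_mult_distrib prod.distrib power_sum)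
  then show ?thesis
    by (simp add: mpol_eval_mono sum_distrib_left mult_ac)
qed

lemma gal_Q_simps:
  assumes "\<sigma> \<in> gal_Q"
  shows "\<sigma> (x + y) = \<sigma> x + \<sigma> y" "\<sigma> (x * y) = \<sigma> x * \<sigma> y" "\<sigma> 0 = 0" "\<sigma> 1 = 1"
    "\<sigma> (- x) = - \<sigma> x" "\<sigma> (x - y) = \<sigma> x - \<sigma> y" "\<sigma> x = \<sigma> y \<longleftrightarrow> x = y" "\<sigma> x = 0 \<longleftrightarrow> x = 0"
    "\<sigma> (inverse x) = inverse (\<sigma> x)" "\<sigma> (x / y) = \<sigma> x / \<sigma> y" "\<sigma> (x ^ n) = \<sigma> x ^ n"
    "\<sigma> (numeral k) = numeral k"
proof -
  have bij: "bij \<sigma>" and add: "\<sigma> (x + y) = \<sigma> x + \<sigma> y" and mult: "\<sigma> (x * y) = \<sigma> x * \<sigma> y" for x y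
    using assms by (auto simp: gal_Q_def)
  show "\<sigma> (x + y) = \<sigma> x + \<sigma> y" "\<sigma> (x * y) = \<sigma> x * \<sigma> y" by (fact add mult)+
  show zero: "\<sigma> 0 = 0" using add[of 0 0] by simp
  show inj: "\<sigma> x = \<sigma> y \<longleftrightarrow> x = y" for x y using bij by (metis bij_pointE)
  show zero_iff: "\<sigma> x = 0 \<longleftrightarrow> x = 0" for x using inj[of x 0] zero by simp
  show one: "\<sigma> 1 = 1" using mult[of 1 1] zero_iff[of 1] by simp
  show minus: "\<sigma> (- x) = - \<sigma> x" for x using add[of x "- x"] zero by (simp add: eq_neg_iff_add_eq_0 add.commute)
  show "\<sigma> (x - y) = \<sigma> x - \<sigma> y" using add[of x "- y"] minus by simp
  show inv: "\<sigma> (inverse x) = inverse (\<sigma> x)" for x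
  proof (cases "x = 0")
    case False
    then have "\<sigma> x * \<sigma> (inverse x) = 1" using mult[of x "inverse x"] one by simp
    then show ?thesis by (metis inverse_unique)
  qed (simp add: zero)
  show "\<sigma> (x / y) = \<sigma> x / \<sigma> y" by (simp add: divide_inverse mult inv)
  show "\<sigma> (x ^ n) = \<sigma> x ^ n" by (induction n) (simp_all add: one mult)
  have "\<sigma> (of_nat n) = of_nat n" for n by (induction n) (simp_all add: zero one add)
  from this[of "numeral k"] show "\<sigma> (numeral k) = numeral k" by simp
qed

lemma fixed_is_subfield: "\<sigma> \<in> gal_Q \<Longrightarrow> is_subfield {x. \<sigma> x = x}"
  by (simp add: is_subfield_def gal_Q_simps)

lemma gal_Q_Rats: "\<sigma> \<in> gal_Q \<Longrightarrow> c \<in> \<rat> \<Longrightarrow> \<sigma> c = c"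
  using is_subfield_Rats[OF fixed_is_subfield] by blast

lemma gal_Q_sum: "\<sigma> \<in> gal_Q \<Longrightarrow> \<sigma> (\<Sum>i\<in>A. h i) = (\<Sum>i\<in>A. \<sigma> (h i))"
  by (induction A rule: infinite_finite_induct) (simp_all add: gal_Q_simps)

lemma gal_Q_prod: "\<sigma> \<in> gal_Q \<Longrightarrow> \<sigma> (\<Prod>i\<in>A. h i) = (\<Prod>i\<in>A. \<sigma> (h i))"
  by (induction A rule: infinite_finite_induct) (simp_all add: gal_Q_simps)

lemma gal_Q_mpol_eval:
  assumes "\<sigma> \<in> gal_Q" "rational_form m d F"
  shows "\<sigma> (mpol_eval F v) = mpol_eval F (\<sigma> \<circ> v)"
  using assms(1)
  by (simp add: mpol_eval_def gal_Q_sum gal_Q_prod gal_Q_simps gal_Q_Rats rational_formD(3)[OF assms(2)])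

section \<open>Residue field and stabilizer of a point\<close>

lemma proj_space_class:
  assumes "p \<in> proj_space m" "v \<in> p"
  shows "p = {(\<lambda>i. c * v i) | c. c \<noteq> 0}"
proof -
  obtain w where w: "p = {(\<lambda>i. c * w i) | c. c \<noteq> 0}"
    using assms(1) unfolding proj_space_def by blast
  then obtain c where c: "c \<noteq> 0" "v = (\<lambda>i. c * w i)"
    using assms(2) by blast
  have "(\<lambda>i. d * w i) = (\<lambda>i. (d / c) * v i)" "(\<lambda>i. d * v i) = (\<lambda>i. (d * c) * w i)" for d
    using c by (simp_all add: fun_eq_iff)
  moreover have "d / c \<noteq> 0" "d * c \<noteq> 0" if "d \<noteq> 0" for d
    using c(1) that by simp_all
  ultimately show ?thesis
    unfolding w by blast
qed

lemma proj_space_obtain: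
  assumes "p \<in> proj_space m"
  obtains v k where "v \<in> p" "v k = 1" "k \<le> m" "\<And>i. i > m \<Longrightarrow> v i = 0"
proof -
  obtain w where w: "p = {(\<lambda>i. c * w i) | c. c \<noteq> 0}" "w \<noteq> (\<lambda>i. 0)" "\<And>i. i > m \<Longrightarrow> w i = 0"
    using assms unfolding proj_space_def by blast
  then obtain k where k: "w k \<noteq> 0" by auto
  show ?thesis
  proof (rule that)
    show "(\<lambda>i. inverse (w k) * w i) \<in> p"
      unfolding w(1) by (rule CollectI, rule exI[of _ "inverse (w k)"]) (use k in simp)
    show "k \<le> m" using k w(3) by (meson not_le)
  qed (use k w(3) in auto)
qed

text \<open>Numerator and denominator have the same degree, so a change of representative cancels.
  Field operations can then be carried out at one fixed vector.\<close>

lemma residue_field_normal: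
  assumes "p \<in> proj_space m" "v \<in> p"
  shows "residue_field m p = {mpol_eval F v / mpol_eval G v | F G d.
     rational_form m d F \<and> rational_form m d G \<and> mpol_eval G v \<noteq> 0}"
proof -
  have "mpol_eval F w / mpol_eval G w = mpol_eval F v / mpol_eval G v \<and> mpol_eval G v \<noteq> 0"
    if "w \<in> p" "rational_form m d F" "rational_form m d G" "mpol_eval G w \<noteq> 0" for w d F G
  proof -
    obtain c where "c \<noteq> 0" "w = (\<lambda>i. c * v i)"
      using proj_space_class[OF assms] \<open>w \<in> p\<close> by blast
    then show ?thesis
      using that(4) by (simp add: mpol_eval_scale[OF that(2)] mpol_eval_scale[OF that(3)])
  qed
  then show ?thesis
    unfolding residue_field_def using assms(2) by blast
qed

lemma residue_field_is_subfield:
  assumes "p \<in> proj_space m"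
  shows "is_subfield (residue_field m p)"
proof -
  obtain v where v: "v \<in> p" using assms by (rule proj_space_obtain)
  have I: "mpol_eval F v / mpol_eval G v \<in> residue_field m p"
    if "rational_form m d F" "rational_form m d G" "mpol_eval G v \<noteq> 0" for F G d
    unfolding residue_field_normal[OF assms v] using that by blast
  show ?thesis
    unfolding is_subfield_def
  proof (intro conjI ballI)
    show "1 \<in> residue_field m p"
      using I[of 0 "Poly_Mapping.single 0 1" "Poly_Mapping.single 0 1"]
      by (simp add: rational_form_const mpol_eval_const del: single_one)
  next
    fix x y assume "x \<in> residue_field m p" "y \<in> residue_field m p"
    then obtain F G d F' G' d' where x: "x = mpol_eval F v / mpol_eval G v" "rational_form m d F"
        "rational_form m d G" "mpol_eval G v \<noteq> 0"
      and y: "y = mpol_eval F' v / mpol_eval G' v" "rational_form m d' F'"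
        "rational_form m d' G'" "mpol_eval G' v \<noteq> 0"
      unfolding residue_field_normal[OF assms v] by blast
    have "rational_form m (d + d') (F' * G)"
      using rational_form_mult[OF y(2) x(3)] by (simp only: add.commute)
    from rational_form_add[OF rational_form_mult[OF x(2) y(3)] this]
    have "rational_form m (d + d') (F * G' + F' * G)" .
    from I[OF this rational_form_mult[OF x(3) y(3)]] show "x + y \<in> residue_field m p"
      using x(4) y(4) by (simp add: x(1) y(1) mpol_eval_mult mpol_eval_add add_frac_eq)
    from I[OF rational_form_mult[OF x(2) y(2)] rational_form_mult[OF x(3) y(3)]]
    show "x * y \<in> residue_field m p"
      using x(4) y(4) by (simp add: x(1) y(1) mpol_eval_mult)
  next
    fix x assume "x \<in> residue_field m p"
    then obtain F G d where x: "x = mpol_eval F v / mpol_eval G v" "rational_form m d F"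
        "rational_form m d G" "mpol_eval G v \<noteq> 0"
      unfolding residue_field_normal[OF assms v] by blast
    have "rational_form m d (Poly_Mapping.single 0 (-1) * F)"
      using rational_form_mult[OF rational_form_const[of "-1"] x(2)] by simp
    from I[OF this x(3,4)] show "- x \<in> residue_field m p"
      by (simp only: mpol_eval_mult mpol_eval_const x(1)) simp
    show "inverse x \<in> residue_field m p"
    proof (cases "mpol_eval F v = 0")
      case True
      with \<open>x \<in> residue_field m p\<close> show ?thesis by (simp add: x(1))
    next
      case False
      from I[OF x(3,2) this] show ?thesis by (simp add: x(1))
    qed
  qed
qed

text \<open>If the point is fixed, \<open>\<sigma>\<close> rescales a representative and the factor
  cancels in fractions of degree 0. Conversely, for a representative with k-th coordinate 1, the
  i-th coordinate is the value of X_i / X_k, so \<open>\<sigma>\<close> fixes that vector.\<close>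

lemma conj_point_fixed_iff:
  assumes p: "p \<in> proj_space m" and \<sigma>: "\<sigma> \<in> gal_Q"
  shows "conj_point \<sigma> p = p \<longleftrightarrow> (\<forall>\<alpha>\<in>residue_field m p. \<sigma> \<alpha> = \<alpha>)"
proof
  assume stab: "conj_point \<sigma> p = p"
  show "\<forall>\<alpha>\<in>residue_field m p. \<sigma> \<alpha> = \<alpha>"
  proof
    fix \<alpha> assume "\<alpha> \<in> residue_field m p"
    then obtain v F G d where \<alpha>: "v \<in> p" "\<alpha> = mpol_eval F v / mpol_eval G v"
      "rational_form m d F" "rational_form m d G"
      unfolding residue_field_def by blast
    have "\<sigma> \<circ> v \<in> p"
      using stab \<alpha>(1) unfolding conj_point_def by blast
    then obtain c where c: "c \<noteq> 0" "\<sigma> \<circ> v = (\<lambda>i. c * v i)"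
      using proj_space_class[OF p \<alpha>(1)] by blast
    show "\<sigma> \<alpha> = \<alpha>"
      using \<alpha>(3,4) c(1) by (simp add: \<alpha>(2) gal_Q_simps[OF \<sigma>] gal_Q_mpol_eval[OF \<sigma>] c(2) mpol_eval_scale)
  qed
next
  assume stab: "\<forall>\<alpha>\<in>residue_field m p. \<sigma> \<alpha> = \<alpha>"
  obtain v k where v: "v \<in> p" "v k = 1" "k \<le> m" "\<And>i. i > m \<Longrightarrow> v i = 0"
    using p by (rule proj_space_obtain) blast
  have "\<sigma> (v i) = v i" for i
  proof (cases "i \<le> m")
    case True
    let ?X = "\<lambda>i. Poly_Mapping.single (Poly_Mapping.single i 1) 1 :: mpol"
    have "mpol_eval (?X i) v / mpol_eval (?X k) v \<in> residue_field m p"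
      unfolding residue_field_def
      using v rational_form_var[OF True] rational_form_var[OF v(3)] mpol_eval_var[of k v] zero_neq_one by fastforce
    with stab show ?thesis by (simp only: mpol_eval_var v(2) div_by_1)
  next
    case False
    then show ?thesis by (simp add: v(4) gal_Q_simps[OF \<sigma>])
  qed
  then have conj: "\<sigma> \<circ> (\<lambda>i. c * v i) = (\<lambda>i. \<sigma> c * v i)" for c
    by (simp add: fun_eq_iff gal_Q_simps[OF \<sigma>])
  have surj: "\<exists>d. d \<noteq> 0 \<and> c = \<sigma> d" if "c \<noteq> 0" for c
  proof -
    have "surj \<sigma>" using \<sigma> by (simp add: gal_Q_def bij_is_surj)
    then obtain d where "c = \<sigma> d" by (metis surjD)
    with that show ?thesis by (auto simp: gal_Q_simps[OF \<sigma>])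
  qed
  show "conj_point \<sigma> p = p"
  proof (intro equalityI subsetI)
    fix w assume "w \<in> conj_point \<sigma> p"
    then obtain c where "c \<noteq> 0" "w = (\<lambda>i. \<sigma> c * v i)"
      unfolding conj_point_def proj_space_class[OF p v(1)] using conj by auto
    then show "w \<in> p"
      unfolding proj_space_class[OF p v(1)] using gal_Q_simps(8)[OF \<sigma>] by blast
  next
    fix w assume "w \<in> p"
    then obtain c where "c \<noteq> 0" "w = (\<lambda>i. c * v i)"
      unfolding proj_space_class[OF p v(1)] by blast
    with surj obtain d where "d \<noteq> 0" "w = \<sigma> \<circ> (\<lambda>i. d * v i)"
      using conj by metis
    then show "w \<in> conj_point \<sigma> p"
      unfolding conj_point_def proj_space_class[OF p v(1)] by blast
  qed
qed

text \<open>An element of \<open>K\<close> outside \<open>L\<close> would be moved by an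
  automorphism fixing \<open>L\<close> pointwise.\<close>

lemma subfield_le_by_galois:
  assumes "is_subfield L" "\<And>\<sigma>. \<sigma> \<in> gal_Q \<Longrightarrow> (\<And>x. x \<in> L \<Longrightarrow> \<sigma> x = x) \<Longrightarrow> \<forall>x\<in>K. \<sigma> x = x"
  shows "K \<subseteq> L"
  using separating_automorphism[OF assms(1)] assms(2) by blast

section \<open>The compositum as least common overfield\<close>

lemma ring_of_type_algebra_inverses:
  fixes x :: qbar
  shows "\<ominus>\<^bsub>ring_of_type_algebra\<^esub> x = - x"
    and "x \<noteq> 0 \<Longrightarrow> inv\<^bsub>ring_of_type_algebra\<^esub> x = inverse x"
proof -
  let ?R = "ring_of_type_algebra :: qbar ring"
  interpret cring ?R by (rule cring_from_type_algebra)
  show "\<ominus>\<^bsub>?R\<^esub> x = - x"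
    by (rule minus_equality) (simp_all add: ring_of_type_algebra_def)
  show "inv\<^bsub>?R\<^esub> x = inverse x" if "x \<noteq> 0"
    by (rule comm_inv_char) (use that in \<open>simp_all add: ring_of_type_algebra_def\<close>)
qed

lemma ring_of_type_algebra_simps:
  "carrier ring_of_type_algebra = UNIV" "\<one>\<^bsub>ring_of_type_algebra\<^esub> = 1" "\<zero>\<^bsub>ring_of_type_algebra\<^esub> = 0"
  "x \<oplus>\<^bsub>ring_of_type_algebra\<^esub> y = x + y" "x \<otimes>\<^bsub>ring_of_type_algebra\<^esub> y = x * y"
  by (simp_all add: ring_of_type_algebra_def)

lemma compositum_is_subfield: "is_subfield (compositum K L)"
proof -
  let ?C = "generate_field (ring_of_type_algebra :: qbar ring) (K \<union> L)"
  \<comment> \<open>Obtained as 1 - 1. It covers \<open>inverse 0 = 0\<close>, as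
    \<open>generate_field.m_inv\<close> applies to nonzero elements only.\<close>
  have zero: "0 \<in> ?C"
  proof -
    have "\<one>\<^bsub>ring_of_type_algebra\<^esub> \<oplus>\<^bsub>ring_of_type_algebra\<^esub> \<ominus>\<^bsub>ring_of_type_algebra\<^esub> \<one>\<^bsub>ring_of_type_algebra\<^esub> \<in> ?C"
      by (intro generate_field.eng_add generate_field.a_inv generate_field.one)
    then show ?thesis
      by (simp add: ring_of_type_algebra_simps ring_of_type_algebra_inverses)
  qed
  show ?thesis
    unfolding is_subfield_def compositum_def
  proof (intro conjI ballI)
    show "1 \<in> ?C"
      using generate_field.one[where R = "ring_of_type_algebra :: qbar ring" and H = "K \<union> L"]
      by (simp only: ring_of_type_algebra_simps)
  next
    fix x y assume xy: "x \<in> ?C" "y \<in> ?C"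
    show "x + y \<in> ?C"
      using generate_field.eng_add[OF xy] by (simp only: ring_of_type_algebra_simps)
    show "x * y \<in> ?C"
      using generate_field.eng_mult[OF xy] by (simp only: ring_of_type_algebra_simps)
  next
    fix x assume x: "x \<in> ?C"
    show "- x \<in> ?C"
      using generate_field.a_inv[OF x] by (simp only: ring_of_type_algebra_inverses)
    show "inverse x \<in> ?C"
    proof (cases "x = 0")
      case True
      with zero show ?thesis by simp
    next
      case False
      have "inv\<^bsub>ring_of_type_algebra\<^esub> x \<in> ?C"
        by (rule generate_field.m_inv[OF x]) (use False in \<open>simp add: ring_of_type_algebra_simps\<close>)
      then show ?thesis by (simp only: ring_of_type_algebra_inverses(2)[OF False])
    qed
  qed
qed

lemma compositum_least:
  assumes M: "is_subfield M" and sub: "K \<subseteq> M" "L \<subseteq> M"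
  shows "compositum K L \<subseteq> M"
proof
  fix x assume "x \<in> compositum K L"
  then show "x \<in> M"
    unfolding compositum_def
    by (induction rule: generate_field.induct)
       (use sub is_subfieldD[OF M] in \<open>auto simp: ring_of_type_algebra_simps ring_of_type_algebra_inverses\<close>)
qed

lemma compositum_contains: "K \<subseteq> compositum K L" "L \<subseteq> compositum K L"
  unfolding compositum_def by (auto intro: generate_field.incl)

section \<open>Isomorphism classes of pairs\<close>

lemma (in group) generate_nat_pow_mono:
  assumes a: "a \<in> carrier G" and b: "b \<in> generate G {a}"
  shows "b [^] (k :: nat) \<in> generate G {a [^] k}"
proof -
  obtain z :: int where z: "b = a [^] z"
    using b generate_pow[OF a] by blast
  have "b [^] k = (a [^] k) [^] z"
    unfolding z using a by (metis int_pow_int int_pow_pow mult.commute)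
  then show ?thesis
    using generate_pow[OF nat_pow_closed[OF a]] by blast
qed

lemma (in group) generate_singleton_subset:
  assumes "a \<in> carrier G" "b \<in> generate G {a}"
  shows "generate G {b} \<subseteq> generate G {a}"
  using assms generate_is_subgroup[of "{a}"] by (intro generate_subgroup_incl) auto

lemma (in group) generate_nat_pow_cong:
  assumes "a \<in> carrier G" "b \<in> carrier G" "generate G {a} = generate G {b}"
  shows "generate G {a [^] (k :: nat)} = generate G {b [^] k}"
  using assms generate.incl[of a "{a}" G] generate.incl[of b "{b}" G]
  by (intro equalityI generate_singleton_subset generate_nat_pow_mono) auto

text \<open>A Bezout relation. It serves for the image of \<open>P\<close> under an automorphism,
  two coprime multiples of which are known to lie in the subgroup generated by
  \<open>P\<close>.\<close>

lemma (in group) generate_of_coprime_powers: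
  assumes a: "a \<in> carrier G" and H: "subgroup H G"
    and k: "a [^] (k :: nat) \<in> H" and l: "a [^] (l :: nat) \<in> H" and "coprime k l"
  shows "a \<in> H"
proof -
  obtain u v :: int where uv: "u * int k + v * int l = 1"
    using bezout_int[of "int k" "int l"] \<open>coprime k l\<close> by (metis coprime_iff_gcd_eq_1 coprime_int_iff)
  have "a = a [^] (int k * u + int l * v)"
    using uv a by (simp add: mult.commute int_pow_1)
  also have "\<dots> = (a [^] k) [^] u \<otimes> (a [^] l) [^] v"
    using a by (simp add: int_pow_mult int_pow_pow flip: int_pow_int)
  also have "\<dots> \<in> H"
    using subgroup.m_closed[OF H] subgroup_int_pow_closed[OF H] k l by blast
  finally show ?thesis .
qed

section \<open>Scalings and Galois conjugation respect the addition law\<close>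

lemma ec_scale_add:
  assumes "u \<noteq> 0"
  shows "ec_add (u ^ 4 * a, u ^ 6 * b) (ec_scale u P) (ec_scale u Q) = ec_scale u (ec_add (a, b) P Q)"
proof (cases P)
  case (Affine x1 y1)
  show ?thesis
  proof (cases Q)
    case (Affine x2 y2)
    have eqs: "u ^ 2 * x1 = u ^ 2 * x2 \<longleftrightarrow> x1 = x2" "u ^ 3 * y1 = - (u ^ 3 * y2) \<longleftrightarrow> y1 = - y2"
      using assms by (simp_all flip: mult_minus_right)
    show ?thesis
    proof (cases "x1 = x2 \<and> y1 = - y2")
      case True
      then show ?thesis using \<open>P = Affine x1 y1\<close> Affine by simp
    next
      case False
      define l where "l = (if x1 = x2 then (3 * x1 ^ 2 + a) / (2 * y1) else (y2 - y1) / (x2 - x1))"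
      define l' where "l' = (if u ^ 2 * x1 = u ^ 2 * x2 then (3 * (u ^ 2 * x1) ^ 2 + u ^ 4 * a) / (2 * (u ^ 3 * y1))
          else (u ^ 3 * y2 - u ^ 3 * y1) / (u ^ 2 * x2 - u ^ 2 * x1))"
      \<comment> \<open>A slope is a quotient of y by x and therefore scales by u^3 / u^2.\<close>
      have l': "l' = u * l"
      proof (cases "x1 = x2")
        case True
        have "3 * (u ^ 2 * x1) ^ 2 + u ^ 4 * a = (u ^ 3 * u) * (3 * x1 ^ 2 + a)"
          by (simp add: power2_eq_square eval_nat_numeral algebra_simps)
        then have "l' = (u ^ 3 * u) * (3 * x1 ^ 2 + a) / (2 * (u ^ 3 * y1))"
          using True by (simp add: l'_def)
        also have "\<dots> = u * l"
          using assms True by (simp add: l_def)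
        finally show ?thesis .
      next
        case False
        have "u ^ 3 * y2 - u ^ 3 * y1 = u ^ 2 * (u * (y2 - y1))" "u ^ 2 * x2 - u ^ 2 * x1 = u ^ 2 * (x2 - x1)"
          by (simp_all add: power2_eq_square eval_nat_numeral algebra_simps)
        then have "l' = u ^ 2 * (u * (y2 - y1)) / (u ^ 2 * (x2 - x1))"
          using False eqs(1) by (simp only: l'_def if_False)
        also have "\<dots> = u * l"
          using assms False by (simp add: l_def)
        finally show ?thesis .
      qed
      have "ec_add (a, b) P Q = Affine (l ^ 2 - x1 - x2) (l * (x1 - (l ^ 2 - x1 - x2)) - y1)"
        using False unfolding \<open>P = Affine x1 y1\<close> Affine l_def by (simp add: Let_def)
      moreover have "ec_add (u ^ 4 * a, u ^ 6 * b) (ec_scale u P) (ec_scale u Q)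
          = Affine (l' ^ 2 - u ^ 2 * x1 - u ^ 2 * x2) (l' * (u ^ 2 * x1 - (l' ^ 2 - u ^ 2 * x1 - u ^ 2 * x2)) - u ^ 3 * y1)"
        using False unfolding \<open>P = Affine x1 y1\<close> Affine l'_def ec_scale.simps ec_add.simps Let_def eqs by (simp only: if_False)
      ultimately show ?thesis
        unfolding l' by (simp add: power2_eq_square eval_nat_numeral algebra_simps)
    qed
  qed (use Affine in auto)
qed auto

lemma map_ec_point_add:
  assumes "\<sigma> \<in> gal_Q"
  shows "ec_add (\<sigma> a, \<sigma> b) (map_ec_point \<sigma> P) (map_ec_point \<sigma> Q) = map_ec_point \<sigma> (ec_add (a, b) P Q)"
proof -
  have neg: "\<sigma> y1 = - \<sigma> y2 \<longleftrightarrow> y1 = - y2" for y1 y2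
    using gal_Q_simps(5,7)[OF assms] by metis
  show ?thesis
    by (cases P; cases Q) (simp_all add: Let_def gal_Q_simps[OF assms] neg)
qed

lemma ec_scale_on_curve:
  assumes "on_curve (a, b) P"
  shows "on_curve (u ^ 4 * a, u ^ 6 * b) (ec_scale u P)"
proof (cases P)
  case (Affine x y)
  have "(u ^ 3 * y) ^ 2 = u ^ 6 * (x ^ 3 + a * x + b)"
    using assms Affine by (simp add: power_mult_distrib flip: power_mult)
  also have "\<dots> = (u ^ 2 * x) ^ 3 + u ^ 4 * a * (u ^ 2 * x) + u ^ 6 * b"
    by (simp add: power_mult_distrib distrib_left mult_ac flip: power_mult)
  finally show ?thesis using Affine by simp
qed simp

lemma map_ec_point_on_curve:
  assumes "\<sigma> \<in> gal_Q" "on_curve (a, b) P"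
  shows "on_curve (\<sigma> a, \<sigma> b) (map_ec_point \<sigma> P)"
  using assms(2) by (cases P) (auto simp: gal_Q_simps(1,2,11)[OF assms(1), symmetric])

lemma elliptic_conj:
  assumes "\<sigma> \<in> gal_Q"
  shows "elliptic (\<sigma> a, \<sigma> b) \<longleftrightarrow> elliptic (a, b)"
proof -
  have "\<sigma> (4 * a ^ 3 + 27 * b ^ 2) = 4 * \<sigma> a ^ 3 + 27 * \<sigma> b ^ 2"
    by (simp add: gal_Q_simps[OF assms])
  with gal_Q_simps(8)[OF assms] show ?thesis by (metis elliptic.simps)
qed

lemma inj_map_ec_point:
  assumes "\<sigma> \<in> gal_Q"
  shows "inj (map_ec_point \<sigma>)"
  by (intro ec_point.inj_map injI) (simp add: gal_Q_simps[OF assms])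

lemma inj_ec_scale:
  assumes "u \<noteq> 0"
  shows "inj (ec_scale u)"
proof (rule injI)
  fix P Q assume "ec_scale u P = ec_scale u Q"
  with assms show "P = Q" by (cases P; cases Q) auto
qed

lemma group_hom_map_ec_point:
  assumes "\<sigma> \<in> gal_Q" "elliptic (a, b)"
  shows "group_hom (ec_group (a, b)) (ec_group (\<sigma> a, \<sigma> b)) (map_ec_point \<sigma>)"
proof (intro group_hom.intro group_hom_axioms.intro homI)
  show "group (ec_group (a, b))" "group (ec_group (\<sigma> a, \<sigma> b))"
    using assms elliptic_conj by (blast intro: group_ec_group)+
qed (use assms in \<open>simp_all add: ec_group_def map_ec_point_on_curve map_ec_point_add\<close>)

lemma group_hom_ec_scale:
  assumes "u \<noteq> 0" "elliptic (a, b)" "elliptic (u ^ 4 * a, u ^ 6 * b)"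
  shows "group_hom (ec_group (a, b)) (ec_group (u ^ 4 * a, u ^ 6 * b)) (ec_scale u)"
proof (intro group_hom.intro group_hom_axioms.intro homI)
  show "group (ec_group (a, b))" "group (ec_group (u ^ 4 * a, u ^ 6 * b))"
    using assms by (blast intro: group_ec_group)+
qed (use assms in \<open>simp_all add: ec_group_def ec_scale_on_curve ec_scale_add\<close>)

lemma conj_pair_in_Gamma0_pairs:
  assumes \<sigma>: "\<sigma> \<in> gal_Q" and x: "x \<in> Gamma0_pairs N"
  shows "conj_pair \<sigma> x \<in> Gamma0_pairs N"
proof -
  obtain a b C where abC: "x = ((a, b), C)" by (metis surj_pair)
  with x obtain P where P: "elliptic (a, b)" "P \<in> carrier (ec_group (a, b))"
    "C = generate (ec_group (a, b)) {P}" "card C = N"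
    unfolding Gamma0_pairs_def by blast
  interpret group_hom "ec_group (a, b)" "ec_group (\<sigma> a, \<sigma> b)" "map_ec_point \<sigma>"
    using group_hom_map_ec_point[OF \<sigma> P(1)] .
  have "map_ec_point \<sigma> ` C = generate (ec_group (\<sigma> a, \<sigma> b)) {map_ec_point \<sigma> P}"
    using generate_img[of "{P}"] P by simp
  moreover have "card (map_ec_point \<sigma> ` C) = N"
    using card_image[OF inj_on_subset[OF inj_map_ec_point[OF \<sigma>] subset_UNIV]] P(4) by simp
  moreover have "elliptic (\<sigma> a, \<sigma> b)"
    using elliptic_conj[OF \<sigma>] P(1) by blast
  moreover have "map_ec_point \<sigma> P \<in> carrier (ec_group (\<sigma> a, \<sigma> b))"
    using P(2) hom_closed by blast
  ultimately show ?thesis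
    unfolding abC Gamma0_pairs_def by auto
qed

context modular_curve_X0
begin

lemma moduli_point_proj: "x \<in> Gamma0_pairs N \<Longrightarrow> \<Phi> x \<in> proj_space m"
  using moduli_point curve unfolding smooth_projective_curve_def by blast

lemma residue_field_fixed_iff:
  assumes "x \<in> Gamma0_pairs N" "\<sigma> \<in> gal_Q"
  shows "(\<forall>\<alpha>\<in>residue_field m (\<Phi> x). \<sigma> \<alpha> = \<alpha>) \<longleftrightarrow> pair_iso (conj_pair \<sigma> x) x"
  using conj_point_fixed_iff[OF moduli_point_proj[OF assms(1)] assms(2)]
    galois_equivariant[OF assms(2,1)]
    moduli_eq_iff[OF conj_pair_in_Gamma0_pairs[OF assms(2,1)] assms(1)] by simp

end

section \<open>Comparing isomorphisms on subgroups\<close>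

lemma ec_neg_image_generate:
  assumes "elliptic E" "P \<in> carrier (ec_group E)"
  shows "ec_neg ` generate (ec_group E) {P} = generate (ec_group E) {P}"
proof -
  obtain a b where E: "E = (a, b)" by (cases E)
  interpret weierstrass a b using assms(1) E by unfold_locales simp
  interpret Gr: group "ec_group E" using group_ec_group[OF assms(1)] .
  have sub: "subgroup (generate (ec_group E) {P}) (ec_group E)"
    using Gr.generate_is_subgroup assms(2) by simp
  have neg: "ec_neg Q = inv\<^bsub>ec_group E\<^esub> Q" if "Q \<in> carrier (ec_group E)" for Q
    using that by (intro Gr.inv_equality[symmetric]) (auto simp: ec_group_def E ec_add_neg on_curve_neg)
  have mem: "ec_neg Q \<in> generate (ec_group E) {P}" if "Q \<in> generate (ec_group E) {P}" for Q
    using neg[OF subgroup.mem_carrier[OF sub that]] subgroup.m_inv_closed[OF sub that] by simp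
  show ?thesis
  proof (intro equalityI subsetI)
    fix Q assume "Q \<in> generate (ec_group E) {P}"
    from mem[OF this] show "Q \<in> ec_neg ` generate (ec_group E) {P}"
      by (metis ec_neg_neg imageI)
  qed (use mem in auto)
qed

lemma ec_scale_uminus: "ec_scale (- u) P = ec_neg (ec_scale u P)"
  by (cases P) simp_all

text \<open>Away from \<open>j = 0, 1728\<close> an isomorphism of curves is unique up to sign, and the sign does not
  affect the image of a subgroup.\<close>

lemma pair_iso_scalar_independent:
  assumes E: "elliptic (a, b)" and ab: "a \<noteq> 0" "b \<noteq> 0"
    and u: "a = u ^ 4 * a'" "b = u ^ 6 * b'" and w: "a = w ^ 4 * a'" "b = w ^ 6 * b'"
    and P: "P \<in> carrier (ec_group (a, b))"
    and C: "generate (ec_group (a, b)) {P} = ec_scale w ` D"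
  shows "generate (ec_group (a, b)) {P} = ec_scale u ` D"
proof -
  have nz: "a' \<noteq> 0" "b' \<noteq> 0" "u \<noteq> 0" using ab u by auto
  have 4: "u ^ 4 = w ^ 4" and 6: "u ^ 6 = w ^ 6"
    using u w nz by auto
  have "u ^ 2 * u ^ 4 = u ^ 6" "w ^ 2 * w ^ 4 = w ^ 6"
    by (simp_all flip: power_add)
  with 4 6 have "u ^ 2 * u ^ 4 = w ^ 2 * u ^ 4" by metis
  then have "u ^ 2 = w ^ 2" using nz(3) by (metis mult_right_cancel power_not_zero)
  then have "u = w \<or> u = - w" by (simp add: power2_eq_iff)
  then show ?thesis
  proof
    assume "u = - w"
    then have "ec_scale u ` D = ec_neg ` generate (ec_group (a, b)) {P}"
      unfolding C by (auto simp: ec_scale_uminus image_image)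
    with ec_neg_image_generate[OF E P] show ?thesis by simp
  qed (use C in simp)
qed

text \<open>The numerator of j is a multiple of a^3, and 1728 - j is a multiple of b^2.\<close>

lemma j_inv_nonzero:
  assumes "elliptic (a, b)" "j_inv (a, b) \<notin> {0, 1728}"
  shows "a \<noteq> 0" "b \<noteq> 0"
  using assms by (auto split: if_splits)

lemma pair_iso_conj_iff:
  assumes E: "elliptic E" "j_inv E \<notin> {0, 1728}" and P: "P \<in> carrier (ec_group E)"
    and fin: "finite (generate (ec_group E) {P})" and cop: "coprime k l" and \<sigma>: "\<sigma> \<in> gal_Q"
  defines "C \<equiv> generate (ec_group E) {P}"
    and "C1 \<equiv> generate (ec_group E) {P [^]\<^bsub>ec_group E\<^esub> (k :: nat)}"
    and "C2 \<equiv> generate (ec_group E) {P [^]\<^bsub>ec_group E\<^esub> (l :: nat)}"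
  shows "pair_iso (conj_pair \<sigma> (E, C)) (E, C) \<longleftrightarrow>
    pair_iso (conj_pair \<sigma> (E, C1)) (E, C1) \<and> pair_iso (conj_pair \<sigma> (E, C2)) (E, C2)"
proof -
  obtain a b where ab: "E = (a, b)" by (cases E)
  note E' = E[unfolded ab] and P' = P[unfolded ab]
  define G where "G = ec_group E"
  interpret group G unfolding G_def using group_ec_group[OF E(1)] .
  have PG: "P \<in> carrier G" using P by (simp add: G_def)
  have iso: "pair_iso (conj_pair \<sigma> (E, H)) (E, H) \<longleftrightarrow>
      (\<exists>u. u \<noteq> 0 \<and> a = u ^ 4 * \<sigma> a \<and> b = u ^ 6 * \<sigma> b \<and> H = ec_scale u ` map_ec_point \<sigma> ` H)" for H
    by (simp add: ab)
  \<comment> \<open>The equivalence for one fixed scalar; the \<open>j\<close>-condition matters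
    only for using the same scalar in both conditions on the right.\<close>
  have key: "C = ec_scale u ` map_ec_point \<sigma> ` C \<longleftrightarrow>
      C1 = ec_scale u ` map_ec_point \<sigma> ` C1 \<and> C2 = ec_scale u ` map_ec_point \<sigma> ` C2"
    if u: "u \<noteq> 0" "a = u ^ 4 * \<sigma> a" "b = u ^ 6 * \<sigma> b" for u
  proof -
    \<comment> \<open>\<open>\<sigma>\<close> leads to the conjugate curve and the scaling leads
      back, so the composite is an endomorphism of the group of points, although not given by
      rational functions in general.\<close>
    define \<phi> where "\<phi> = ec_scale u \<circ> map_ec_point \<sigma>"
    have "group_hom (ec_group (\<sigma> a, \<sigma> b)) (ec_group (a, b)) (ec_scale u)"
      using group_hom_ec_scale[OF u(1), of "\<sigma> a" "\<sigma> b"] E'(1) elliptic_conj[OF \<sigma>] u(2,3) by metis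
    then have "group_hom G G \<phi>"
      using group_hom_map_ec_point[OF \<sigma> E'(1)]
      unfolding G_def ab \<phi>_def group_hom_def group_hom_axioms_def
      by (elim conjE) (intro conjI Group.hom_compose[where H = "ec_group (\<sigma> a, \<sigma> b)"])
    then interpret \<phi>: group_hom G G \<phi> .
    have inj: "inj \<phi>"
      unfolding \<phi>_def using inj_compose[OF inj_ec_scale[OF u(1)] inj_map_ec_point[OF \<sigma>]] .
    have img: "ec_scale u ` map_ec_point \<sigma> ` H = \<phi> ` H" for H
      by (simp add: \<phi>_def image_comp)
    have \<phi>P: "\<phi> P \<in> carrier G" using PG by simp
    have gen: "\<phi> ` generate G {Q} = generate G {\<phi> Q}" if "Q \<in> carrier G" for Q
      using \<phi>.generate_img[of "{Q}"] that by simp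
    have pow: "\<phi> ` generate G {P [^]\<^bsub>G\<^esub> j} = generate G {\<phi> P [^]\<^bsub>G\<^esub> j}" for j :: nat
      using gen[of "P [^]\<^bsub>G\<^esub> j"] PG by (simp add: \<phi>.hom_nat_pow)
    have CG: "C = generate G {P}" "C1 = generate G {P [^]\<^bsub>G\<^esub> k}" "C2 = generate G {P [^]\<^bsub>G\<^esub> l}"
      by (simp_all add: C_def C1_def C2_def G_def)
    have sub: "subgroup C G" unfolding CG using PG by (simp add: generate_is_subgroup)
    show ?thesis
      unfolding img
    proof
      assume "C = \<phi> ` C"
      then have "generate G {P} = generate G {\<phi> P}"
        unfolding CG gen[OF PG] .
      then show "C1 = \<phi> ` C1 \<and> C2 = \<phi> ` C2"
        unfolding CG pow using generate_nat_pow_cong[OF PG \<phi>P] by blast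
    next
      assume C12: "C1 = \<phi> ` C1 \<and> C2 = \<phi> ` C2"
      have PC: "P \<in> generate G {P}" by (simp add: generate.incl)
      have "P [^]\<^bsub>G\<^esub> j \<in> C" for j :: nat
        using subgroup_int_pow_closed[OF sub, of P "int j"] PC by (simp add: CG int_pow_int)
      then have "C1 \<subseteq> C" "C2 \<subseteq> C"
        unfolding CG using generate_singleton_subset[OF PG] by blast+
      \<comment> \<open>These powers generate the images of \<open>C1\<close> and \<open>C2\<close>,
        which are \<open>C1\<close> and \<open>C2\<close> again and lie in \<open>C\<close>.\<close>
      moreover have "\<phi> P [^]\<^bsub>G\<^esub> k \<in> C1" "\<phi> P [^]\<^bsub>G\<^esub> l \<in> C2"
        using C12 pow unfolding CG by (auto intro: generate.incl)
      ultimately have "\<phi> P \<in> C"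
        using generate_of_coprime_powers[OF \<phi>P sub _ _ cop] by blast
      then have "\<phi> ` C \<subseteq> C"
        unfolding CG gen[OF PG] using generate_singleton_subset[OF PG] by blast
      \<comment> \<open>An injective map of the finite set \<open>C\<close> into itself is
        onto.\<close>
      with fin inj_on_subset[OF inj subset_UNIV] show "C = \<phi> ` C"
        unfolding C_def by (metis endo_inj_surj)
    qed
  qed
  note nz = j_inv_nonzero[OF E']
  have carr: "P [^]\<^bsub>ec_group E\<^esub> l \<in> carrier (ec_group E)"
    using PG nat_pow_closed unfolding G_def by blast
  show ?thesis
  proof
    assume "pair_iso (conj_pair \<sigma> (E, C)) (E, C)"
    then obtain u where u: "u \<noteq> 0" "a = u ^ 4 * \<sigma> a" "b = u ^ 6 * \<sigma> b" "C = ec_scale u ` map_ec_point \<sigma> ` C"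
      unfolding iso by (elim exE conjE) (rule that)
    show "pair_iso (conj_pair \<sigma> (E, C1)) (E, C1) \<and> pair_iso (conj_pair \<sigma> (E, C2)) (E, C2)"
      unfolding iso using key[OF u(1-3), THEN iffD1, OF u(4)] u(1-3) by (intro conjI exI[of _ u]) simp_all
  next
    assume asm: "pair_iso (conj_pair \<sigma> (E, C1)) (E, C1) \<and> pair_iso (conj_pair \<sigma> (E, C2)) (E, C2)"
    from asm[THEN conjunct1]
    obtain u where u: "u \<noteq> 0" "a = u ^ 4 * \<sigma> a" "b = u ^ 6 * \<sigma> b" "C1 = ec_scale u ` map_ec_point \<sigma> ` C1"
      unfolding iso by (elim exE conjE) (rule that)
    from asm[THEN conjunct2]
    obtain w where w: "a = w ^ 4 * \<sigma> a" "b = w ^ 6 * \<sigma> b" "C2 = ec_scale w ` map_ec_point \<sigma> ` C2"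
      unfolding iso by (elim exE conjE) (rule that)
    \<comment> \<open>The scalar \<open>w\<close> found for \<open>C2\<close> is traded for the
      scalar \<open>u\<close> found for \<open>C1\<close>, so that \<open>key\<close> applies to
      both.\<close>
    have "C2 = ec_scale u ` map_ec_point \<sigma> ` C2"
      using pair_iso_scalar_independent[OF E'(1) nz u(2,3) w(1,2) carr[unfolded ab] w(3)[unfolded C2_def ab]]
      unfolding C2_def ab .
    with u(4) have "C = ec_scale u ` map_ec_point \<sigma> ` C"
      by (rule key[OF u(1-3), THEN iffD2, OF conjI])
    then show "pair_iso (conj_pair \<sigma> (E, C)) (E, C)"
      unfolding iso by (intro exI[of _ u] conjI u(1-3))
  qed
qed

theorem theorem6p8:
  fixes n1 n2 n g m m1 m2 :: nat
    and V V1 V2 :: "ppoint set"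
    and \<Phi> \<Phi>1 \<Phi>2 :: "level_pair \<Rightarrow> ppoint"
    and E :: curve and P :: "qbar ec_point" and x x1 x2 :: ppoint
  assumes "n1 > 0" and "n2 > 0"
    and "n = lcm n1 n2" and "g = gcd n1 n2"
    and "modular_curve_X0 n m V \<Phi>"
    and "modular_curve_X0 n1 m1 V1 \<Phi>1"
    and "modular_curve_X0 n2 m2 V2 \<Phi>2"
    and "elliptic E" and "j_inv E \<notin> {0, 1728}"
    and "P \<in> carrier (ec_group E)" and "card (generate (ec_group E) {P}) = n"
    and "x = \<Phi> (E, generate (ec_group E) {P})"
    and "x1 = \<Phi>1 (E, generate (ec_group E) {P [^]\<^bsub>ec_group E\<^esub> (n2 div g)})"
    and "x2 = \<Phi>2 (E, generate (ec_group E) {P [^]\<^bsub>ec_group E\<^esub> (n1 div g)})"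
  shows "residue_field m x = compositum (residue_field m1 x1) (residue_field m2 x2)"
proof -
  interpret X: modular_curve_X0 n m V \<Phi> by fact
  interpret X1: modular_curve_X0 n1 m1 V1 \<Phi>1 by fact
  interpret X2: modular_curve_X0 n2 m2 V2 \<Phi>2 by fact
  interpret group "ec_group E" using group_ec_group \<open>elliptic E\<close> .
  let ?k = "n2 div g" and ?l = "n1 div g"
  let ?C = "generate (ec_group E) {P}"
  let ?C1 = "generate (ec_group E) {P [^]\<^bsub>ec_group E\<^esub> ?k}"
  let ?C2 = "generate (ec_group E) {P [^]\<^bsub>ec_group E\<^esub> ?l}"
  note P = \<open>P \<in> carrier (ec_group E)\<close>
  have g: "g > 0" "n1 = ?l * g" "n2 = ?k * g"
    using assms(1,2,4) by simp_all
  have n: "n = n1 * ?k" "n = n2 * ?l"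
    using assms(3,4) by (simp_all add: lcm_nat_def div_mult_swap mult.commute)
  have "n > 0"
    using assms(1-3) by (simp add: lcm_pos_nat)
  have pos: "?k > 0" "?l > 0" using n \<open>n > 0\<close> by (auto intro!: gr0I)
  have "ord P = n" using generate_pow_card[OF P] assms(11) by simp
  \<comment> \<open>The order of a power of \<open>P\<close> is \<open>n\<close> divided by its gcd
    with the exponent, and the exponent divides \<open>n\<close>.\<close>
  moreover have "n div gcd n ?k = n1"
    using pos by (simp add: n(1))
  moreover have "n div gcd n ?l = n2"
    using pos by (simp add: n(2))
  ultimately have card: "card ?C1 = n1" "card ?C2 = n2"
    using pos P by (simp_all add: ord_pow_gen flip: generate_pow_card)
  have pair: "(E, ?C) \<in> Gamma0_pairs n" "(E, ?C1) \<in> Gamma0_pairs n1" "(E, ?C2) \<in> Gamma0_pairs n2"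
    using assms(8,11) P card nat_pow_closed[OF P] unfolding Gamma0_pairs_def by blast+
  have cop: "coprime ?k ?l"
    using div_gcd_coprime[of n2 n1] assms(1,2,4) by (simp add: gcd.commute)
  have fin: "finite ?C" using \<open>n > 0\<close> assms(11) by (metis card_gt_0_iff)
  let ?K = "residue_field m x" and ?K1 = "residue_field m1 x1" and ?K2 = "residue_field m2 x2"
  have fixed: "(\<forall>\<alpha>\<in>?K. \<sigma> \<alpha> = \<alpha>) \<longleftrightarrow> (\<forall>\<alpha>\<in>?K1. \<sigma> \<alpha> = \<alpha>) \<and> (\<forall>\<alpha>\<in>?K2. \<sigma> \<alpha> = \<alpha>)" if "\<sigma> \<in> gal_Q" for \<sigma>
    unfolding assms(12-14) X.residue_field_fixed_iff[OF pair(1) that]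
      X1.residue_field_fixed_iff[OF pair(2) that] X2.residue_field_fixed_iff[OF pair(3) that]
    by (rule pair_iso_conj_iff[OF assms(8,9) P fin cop that])
  have K: "is_subfield ?K"
    unfolding assms(12) by (intro residue_field_is_subfield X.moduli_point_proj pair)
  show ?thesis
  proof
    show "?K \<subseteq> compositum ?K1 ?K2"
    proof (rule subfield_le_by_galois[OF compositum_is_subfield])
      fix \<sigma> assume "\<sigma> \<in> gal_Q" "\<And>x. x \<in> compositum ?K1 ?K2 \<Longrightarrow> \<sigma> x = x"
      then show "\<forall>x\<in>?K. \<sigma> x = x" using fixed compositum_contains by blast
    qed
    have "?K1 \<subseteq> ?K" "?K2 \<subseteq> ?K" using fixed by (intro subfield_le_by_galois[OF K]; blast)+
    then show "compositum ?K1 ?K2 \<subseteq> ?K" by (rule compositum_least[OF K])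
  qed
qed

end
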